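(* Let $a,b,c,d,\tau,\eta\in\mathbb{R}$ with $ad-bc=1$ and $b>0$, and let $O_A$ be the offset linear canonical transform with parameter $A=\left[\begin{array}{cc|c} a & b & \tau\\ c & d & \eta\end{array}\right]$. Let $f\in\mathcal{S}(\mathbb{R})$ with $\|f\|_2=1$. Then $$\int_{\mathbb{R}}|f(t)|^2\ln|t|\,\mathrm{d}t+\int_{\mathbb{R}}|O_Af(u)|^2\ln|u|\,\mathrm{d}u\ge\ln b+\frac{\Gamma'(1/4)}{\Gamma(1/4)}.$$
   Context: Here $j$ denotes the imaginary unit, $\mathcal{S}(\mathbb{R})$ is the Schwartz class of (complex-valued) functions on $\mathbb{R}$, $\|\cdot\|_2$ is the $L^2(\mathbb{R})$ norm, and $\Gamma$ is the Gamma function. For real parameters $a,b,c,d,\tau,\eta$ with $ad-bc=1$ and $b>0$, the offset linear canonical transform (OLCT) of a function $f$ on $\mathbb{R}$ is $$O_Af(u)=\int_{-\infty}^{+\infty}f(t)K_A(t,u)\,\mathrm{d}t,\qquad K_A(t,u)=\frac{1}{\sqrt{j2\pi b}}\,e^{j\frac{a}{2b}t^2-j\frac{1}{b}t(u-\tau)-j\frac{1}{b}u(d\tau-b\eta)+j\frac{d}{2b}(u^2+\tau^2)}.$$ *)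

theory Defs
  imports "HOL-Analysis.Analysis"
begin

definition nth_vector_derivative :: "nat \<Rightarrow> (real \<Rightarrow> complex) \<Rightarrow> real \<Rightarrow> complex" where
  "nth_vector_derivative n f = ((\<lambda>g t. vector_derivative g (at t)) ^^ n) f"

definition schwartz :: "(real \<Rightarrow> complex) set" where
  "schwartz = {f.
     (\<forall>n t. nth_vector_derivative n f differentiable (at t)) \<and>
     (\<forall>m n. bounded (range (\<lambda>t. of_real (t ^ m) * nth_vector_derivative n f t)))}"

definition L2_norm :: "(real \<Rightarrow> complex) \<Rightarrow> real" where
  "L2_norm f = sqrt (LBINT t. (cmod (f t))\<^sup>2)"

text \<open>The prefactor uses the principal branch of the square root. The parameter \<open>c\<close> does not
  occur in the kernel; for \<open>b \<noteq> 0\<close> it is determined by \<open>a * d - b * c = 1\<close>.\<close>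

definition olct_kernel ::
  "real \<Rightarrow> real \<Rightarrow> real \<Rightarrow> real \<Rightarrow> real \<Rightarrow> real \<Rightarrow> real \<Rightarrow> real \<Rightarrow> complex" where
  "olct_kernel a b c d \<tau> \<eta> t u =
     1 / csqrt (\<i> * of_real (2 * pi * b)) *
     exp (\<i> * of_real (a / (2 * b) * t\<^sup>2 - 1 / b * t * (u - \<tau>)
                     - 1 / b * u * (d * \<tau> - b * \<eta>) + d / (2 * b) * (u\<^sup>2 + \<tau>\<^sup>2)))"

definition olct ::
  "real \<Rightarrow> real \<Rightarrow> real \<Rightarrow> real \<Rightarrow> real \<Rightarrow> real \<Rightarrow> (real \<Rightarrow> complex) \<Rightarrow> real \<Rightarrow> complex" where
  "olct a b c d \<tau> \<eta> f u = (LBINT t. f t * olct_kernel a b c d \<tau> \<eta> t u)"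

end

theory Submission
  imports Defs "HOL-Probability.Probability"
begin

text \<open>Put \<open>h t = f t * cis (a / (2 * b) * t\<^sup>2 + \<tau> / b * t)\<close>. Then \<open>\<bar>h\<bar> = \<bar>f\<bar>\<close>, and up to a phase the
  transform of \<open>f\<close> at \<open>u\<close> is the unitary Fourier transform \<open>F\<close> of \<open>h\<close> at \<open>u / b\<close>, divided by
  \<open>sqrt b\<close>. This reduces the claim to a logarithmic uncertainty principle for \<open>h\<close> and \<open>F\<close>.

  For that, integrate the autocorrelation
  \<open>Re (\<integral> h (x + t) * cnj (h x) dx) = \<integral> \<bar>F v\<bar>\<^sup>2 * cos (t * v) dv\<close> against \<open>dt / t\<close> over
  \<open>[\<epsilon>, R]\<close>. On the Fourier side the cosine integral is at least
  \<open>- ln \<epsilon> - ln \<bar>v\<bar> - K\<close>, up to an error that vanishes as \<open>R\<close> grows. On the other side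
  the weight \<open>w x = \<bar>x\<bar> powr (- 1/2)\<close> gives
  \<open>\<bar>h x * h (x + t)\<bar> \<le> (\<bar>h x\<bar>\<^sup>2 * w (x + t) / w x + \<bar>h (x + t)\<bar>\<^sup>2 * w x / w (x + t)) / 2\<close>,
  and the resulting integrals over \<open>t\<close> are elementary: they yield
  \<open>- ln \<epsilon> + ln \<bar>x\<bar> + 2 * ln 2 + pi / 2\<close> up to an error that vanishes with \<open>\<epsilon>\<close>. Comparing
  both sides and letting \<open>\<epsilon> \<rightarrow> 0\<close> and \<open>R \<rightarrow> \<infinity>\<close> bounds the sum of the two logarithmic moments below
  by \<open>- K - 2 * ln 2 - pi / 2\<close>, which is at least the digamma function at \<open>1/4\<close>.\<close>

section \<open>The truncated cosine integral\<close>

lemma cos_ge_quadratic: "cos (y::real) \<ge> 1 - y\<^sup>2 / 2"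
proof -
  have "\<bar>sin (y/2)\<bar> \<le> \<bar>y/2\<bar>" by (rule abs_sin_x_le_abs_x)
  then have "(sin (y/2))\<^sup>2 \<le> (y/2)\<^sup>2" by (simp only: abs_le_square_iff)
  then show ?thesis using cos_double_sin[of "y/2"] by (simp add: power_divide)
qed

lemma cos_over_integrable:
  assumes "0 < a" shows "(\<lambda>y::real. cos y / y) integrable_on {a..b}"
  by (rule integrable_continuous_real) (use assms in \<open>auto intro!: continuous_intros\<close>)

text \<open>Integrates \<open>1 / y - y / 2\<close>, which lies below \<open>cos y / y\<close>; the
  nonnegative boundary term \<open>a\<^sup>2 / 4\<close> is dropped.\<close>

lemma integral_cos_over_ge_ln:
  fixes a b :: real
  assumes "0 < a" "a \<le> b"
  shows "integral {a..b} (\<lambda>y. cos y / y) \<ge> ln b - ln a - b\<^sup>2 / 4"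
proof -
  have "((\<lambda>y. 1 / y - y / 2) has_integral (ln b - b\<^sup>2 / 4) - (ln a - a\<^sup>2 / 4)) {a..b}"
    using assms
    by (intro fundamental_theorem_of_calculus)
       (auto simp: has_real_derivative_iff_has_vector_derivative[symmetric]
             intro!: derivative_eq_intros)
  then have "(ln b - b\<^sup>2 / 4) - (ln a - a\<^sup>2 / 4) \<le> integral {a..b} (\<lambda>y. cos y / y)"
  proof (rule has_integral_le)
    show "((\<lambda>y. cos y / y) has_integral integral {a..b} (\<lambda>y. cos y / y)) {a..b}"
      using cos_over_integrable[OF assms(1)] by (rule integrable_integral)
    fix y assume y: "y \<in> {a..b}"
    then have "(1 - y\<^sup>2 / 2) / y \<le> cos y / y"
      using assms cos_ge_quadratic[of y] by (intro divide_right_mono) auto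
    then show "1 / y - y / 2 \<le> cos y / y"
      using y assms by (simp add: field_simps power2_eq_square)
  qed
  moreover have "a\<^sup>2 / 4 \<ge> 0" by simp
  ultimately show ?thesis by linarith
qed

lemma integral_cos_over_le_ln:
  fixes a b :: real
  assumes "0 < a" "a \<le> b"
  shows "integral {a..b} (\<lambda>y. cos y / y) \<le> ln b - ln a"
proof -
  have "((\<lambda>y. 1 / y) has_integral ln b - ln a) {a..b}"
    using assms
    by (intro fundamental_theorem_of_calculus)
       (auto simp: has_real_derivative_iff_has_vector_derivative[symmetric]
             intro!: derivative_eq_intros)
  with integrable_integral[OF cos_over_integrable[OF assms(1)]] show ?thesis
    by (rule has_integral_le) (use assms in \<open>auto intro!: divide_right_mono\<close>)
qed

text \<open>The sine is nonnegative up to \<open>pi\<close> and at least -1 beyond. The term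
  \<open>1 / b\<close> is kept because it absorbs the boundary value \<open>sin b / b\<close> in the
  integration by parts that uses this bound.\<close>

lemma integral_sin_over_square_ge:
  fixes b :: real
  assumes "0 < c" "c \<le> pi" "c \<le> b"
  shows "integral {c..b} (\<lambda>y. sin y / y\<^sup>2) \<ge> - 1 / pi + (if b \<le> pi then 1 / pi else 1 / b)"
proof (cases "b \<le> pi")
  case True
  then show ?thesis using assms 
    by (auto intro!: integral_nonneg integrable_continuous_real continuous_intros divide_nonneg_nonneg sin_ge_zero)
next
  case False
  have int: "(\<lambda>y. sin y / y\<^sup>2) integrable_on {c..b}"
    using assms by (auto intro!: integrable_continuous_real continuous_intros)
  have 1: "integral {c..pi} (\<lambda>y. sin y / y\<^sup>2) \<ge> 0"
    using assms
    by (auto intro!: integral_nonneg integrable_continuous_real continuous_intros divide_nonneg_nonneg sin_ge_zero)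
  have "((\<lambda>y. - 1 / y\<^sup>2) has_integral 1 / b - 1 / pi) {pi..b}"
    using False
    by (intro fundamental_theorem_of_calculus)
       (auto simp: has_real_derivative_iff_has_vector_derivative[symmetric] power2_eq_square
             dest: order.strict_trans2[OF pi_gt_zero] intro!: derivative_eq_intros)
  then have "1 / b - 1 / pi \<le> integral {pi..b} (\<lambda>y. sin y / y\<^sup>2)"
  proof (rule has_integral_le)
    show "((\<lambda>y. sin y / y\<^sup>2) has_integral integral {pi..b} (\<lambda>y. sin y / y\<^sup>2)) {pi..b}"
      by (rule integrable_integral, rule integrable_continuous_real)
         (auto intro!: continuous_intros dest: order.strict_trans2[OF pi_gt_zero])
    show "- 1 / y\<^sup>2 \<le> sin y / y\<^sup>2" for y :: real
      by (intro divide_right_mono) auto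
  qed
  with 1 Henstock_Kurzweil_Integration.integral_combine[OF assms(2) _ int] False show ?thesis
    by simp
qed

text \<open>As \<open>b\<close> tends to infinity and \<open>a\<close> to 0, the optimal constant is the Euler-Mascheroni
  constant. The one below is larger, by less than \<open>ln 2\<close>; the theorem falls short of the sharp
  inequality by exactly \<open>ln 2\<close>.\<close>

lemma integral_cos_over_ge:
  fixes a b :: real
  assumes "0 < a" "a \<le> b"
  shows "integral {a..b} (\<lambda>y. cos y / y)
         \<ge> - ln a - (1/2 - ln 2 / 2 + 1 / sqrt 2 + 1 / pi) - 2 / sqrt b"
proof -
  \<comment> \<open>The split point \<open>sqrt 2\<close> maximises
    \<open>ln c - c\<^sup>2 / 4\<close>, the part of the lower bound on \<open>{a..c}\<close> that
    depends on \<open>c\<close>.\<close>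
  define c :: real where "c = sqrt 2"
  have c: "0 < c" "c \<le> pi" "c\<^sup>2 = 2" "ln c = ln 2 / 2"
    using sqrt_le_D[of 2 2] pi_gt3 real_sqrt_le_mono[of 2 4] by (auto simp: c_def ln_sqrt)
  have b: "0 < b" using assms by simp
  have l2: "ln 2 \<le> (1::real)" using ln_le_minus_one[of 2] by simp
  have tail: "integral {c..b'} (\<lambda>y. cos y / y) \<ge> - 1 / sqrt 2 - 1 / pi" if "c \<le> b'" for b'
  proof -
    have b': "b' > 0" using that c by simp
    \<comment> \<open>Integration by parts: the primitive is \<open>sin y / y\<close>, and the
      remaining integrand is controlled by the preceding lemma.\<close>
    have "((\<lambda>y. cos y / y - sin y / y\<^sup>2) has_integral sin b' / b' - sin c / c) {c..b'}"
      using that c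
      by (intro fundamental_theorem_of_calculus)
         (auto simp: has_real_derivative_iff_has_vector_derivative[symmetric] field_simps power2_eq_square
               intro!: derivative_eq_intros)
    moreover have "((\<lambda>y. sin y / y\<^sup>2) has_integral integral {c..b'} (\<lambda>y. sin y / y\<^sup>2)) {c..b'}"
      by (rule integrable_integral, rule integrable_continuous_real)
         (use c in \<open>auto intro!: continuous_intros\<close>)
    ultimately have "((\<lambda>y. (cos y / y - sin y / y\<^sup>2) + sin y / y\<^sup>2) has_integral
        (sin b' / b' - sin c / c) + integral {c..b'} (\<lambda>y. sin y / y\<^sup>2)) {c..b'}"
      by (rule has_integral_add)
    then have eq: "integral {c..b'} (\<lambda>y. cos y / y)
      = sin b' / b' - sin c / c + integral {c..b'} (\<lambda>y. sin y / y\<^sup>2)"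
      by (simp add: integral_unique)
    have "sin c / c \<le> 1 / sqrt 2" unfolding c_def by (intro divide_right_mono) auto
    moreover have "sin b' / b' + (if b' \<le> pi then 1 / pi else 1 / b') \<ge> 0"
    proof (cases "b' \<le> pi")
      case True
      then show ?thesis using b' by (auto intro!: add_nonneg_nonneg divide_nonneg_nonneg sin_ge_zero)
    next
      case False
      have "-1 / b' \<le> sin b' / b'" using b' by (intro divide_right_mono) auto
      with False show ?thesis by simp
    qed
    ultimately show ?thesis
      using integral_sin_over_square_ge[OF c(1,2) that] eq by simp
  qed
  consider "b \<le> c" | "a \<le> c" "c \<le> b" | "c \<le> a" using assms by linarith
  then show ?thesis
  proof cases
    \<comment> \<open>There is no oscillating tail here. The error term \<open>2 / sqrt b\<close>
      compensates a very negative \<open>ln b\<close>, since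
      \<open>ln b \<ge> 2 - 2 / sqrt b\<close>.\<close>
    case 1
    then have "b\<^sup>2 \<le> 2" using b c(3) power_mono[of b c 2] by simp
    moreover have "ln (1 / sqrt b) \<le> 1 / sqrt b - 1" by (rule ln_le_minus_one) (use b in simp)
    then have "- ln b \<le> 2 / sqrt b - 2" using b by (simp add: ln_div ln_sqrt)
    moreover have "1 / sqrt 2 > (0::real)" "1 / pi > 0" by simp_all
    ultimately show ?thesis using integral_cos_over_ge_ln[OF assms] l2 by argo
  next
    case 2
    have "integral {a..b} (\<lambda>y. cos y / y) = integral {a..c} (\<lambda>y. cos y / y) + integral {c..b} (\<lambda>y. cos y / y)"
      by (rule Henstock_Kurzweil_Integration.integral_combine[symmetric, OF 2 cos_over_integrable[OF assms(1)]])
    moreover have "2 / sqrt b > 0" using b by simp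
    ultimately show ?thesis using integral_cos_over_ge_ln[OF assms(1) 2(1)] tail[OF 2(2)] c(3,4) by linarith
  next
    \<comment> \<open>The interval starts beyond the split point, so the piece over
      \<open>{c..a}\<close> is subtracted from the tail; it is at most
      \<open>ln a - ln c\<close>.\<close>
    case 3
    then have "integral {c..b} (\<lambda>y. cos y / y) = integral {c..a} (\<lambda>y. cos y / y) + integral {a..b} (\<lambda>y. cos y / y)"
      by (intro Henstock_Kurzweil_Integration.integral_combine[symmetric] cos_over_integrable assms c)
    moreover have "2 / sqrt b > 0" using b by simp
    moreover have "c \<le> b" using 3 assms by simp
    ultimately show ?thesis using integral_cos_over_le_ln[OF c(1) 3] tail[of b] c(4) l2 by linarith
  qed
qed

text \<open>Substitution \<open>y = t * \<bar>v\<bar>\<close>, the cosine being even. The error is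
  of order \<open>1 / sqrt \<bar>v\<bar>\<close>, a singularity that is integrable at 0 and so
  survives averaging over \<open>v\<close>.\<close>

lemma integral_cos_scaled_over_ge:
  fixes \<epsilon> R v :: real
  assumes "0 < \<epsilon>" "\<epsilon> \<le> R" "v \<noteq> 0"
  shows "integral {\<epsilon>..R} (\<lambda>t. cos (t * v) / t)
         \<ge> - ln \<epsilon> - ln \<bar>v\<bar> - (1/2 - ln 2 / 2 + 1 / sqrt 2 + 1 / pi) - 2 / sqrt (R * \<bar>v\<bar>)"
proof -
  define w where "w = \<bar>v\<bar>"
  have w: "w > 0" using assms by (simp add: w_def)
  have "((\<lambda>y. cos y / y) has_integral integral {\<epsilon> * w..R * w} (\<lambda>y. cos y / y)) {\<epsilon> * w..R * w}"
    by (rule integrable_integral, rule cos_over_integrable) (use w assms in simp)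
  from has_integral_affinity'[OF _ w, of "(\<lambda>y. cos y / y)" _ "\<epsilon> * w" "R * w" 0, unfolded cbox_interval, OF this]
  have "((\<lambda>t. cos (t * w) / (t * w)) has_integral
      integral {\<epsilon> * w..R * w} (\<lambda>y. cos y / y) / w) {\<epsilon>..R}"
    using w by (simp add: ac_simps divide_inverse)
  from has_integral_mult_right[OF this, of w]
  have "((\<lambda>t. cos (t * w) / t) has_integral integral {\<epsilon> * w..R * w} (\<lambda>y. cos y / y)) {\<epsilon>..R}"
    using w by simp
  moreover have "cos (t * v) = cos (t * w)" for t by (auto simp: w_def abs_if)
  ultimately have "integral {\<epsilon>..R} (\<lambda>t. cos (t * v) / t) = integral {\<epsilon> * w..R * w} (\<lambda>y. cos y / y)"
    by (simp add: integral_unique)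
  then show ?thesis using integral_cos_over_ge[of "\<epsilon> * w" "R * w"] w assms
    by (simp add: ln_mult w_def[symmetric])
qed

section \<open>Integrals of the inverse square root weight\<close>

lemma DERIV_ln_comp:
  fixes g :: "real \<Rightarrow> real"
  assumes "(g has_real_derivative d) (at x)" "g x > 0"
  shows "((\<lambda>x. ln (g x)) has_real_derivative d / g x) (at x)"
  using assms by (auto intro!: derivative_eq_intros simp: divide_inverse)

text \<open>The fundamental theorem for nonnegative integrands on possibly unbounded intervals, in
  the \<open>ennreal\<close> form that combines with Tonelli.\<close>

lemma nn_integral_FTC_einterval:
  fixes f F :: "real \<Rightarrow> real" and a b :: ereal
  assumes "a < b"
    and "\<And>x. a < ereal x \<Longrightarrow> ereal x < b \<Longrightarrow> DERIV F x :> f x"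
    and "\<And>x. a < ereal x \<Longrightarrow> ereal x < b \<Longrightarrow> isCont f x"
    and nonneg: "\<And>x. a < ereal x \<Longrightarrow> ereal x < b \<Longrightarrow> 0 \<le> f x"
    and "((F \<circ> real_of_ereal) \<longlongrightarrow> A) (at_right a)"
    and "((F \<circ> real_of_ereal) \<longlongrightarrow> B) (at_left b)"
  shows "(\<integral>\<^sup>+x. ennreal (f x) * indicator (einterval a b) x \<partial>lborel) = ennreal (B - A)"
proof -
  note FTC = interval_integral_FTC_nonneg[OF assms(1-3) _ assms(5,6)]
  have "integrable lborel (\<lambda>x. indicator (einterval a b) x *\<^sub>R f x)"
    using FTC(1) nonneg by (simp add: set_integrable_def)
  then have "(\<integral>\<^sup>+x. ennreal (indicator (einterval a b) x *\<^sub>R f x) \<partial>lborel)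
      = ennreal (LBINT x. indicator (einterval a b) x *\<^sub>R f x)"
    by (rule nn_integral_eq_integral)
       (use nonneg in \<open>auto simp: einterval_def indicator_def\<close>)
  also have "(LBINT x. indicator (einterval a b) x *\<^sub>R f x) = B - A"
    using FTC(2) nonneg less_imp_le[OF assms(1)]
    by (simp add: interval_lebesgue_integral_def set_lebesgue_integral_def)
  finally show ?thesis
    by (rule trans[rotated]) (auto intro!: nn_integral_cong simp: indicator_def)
qed

text \<open>The integrand is the weight ratio \<open>w (y + t) / w y\<close> over \<open>t\<close>.
  In \<open>s = sqrt (y + t)\<close> it becomes rational, with a logarithmic primitive
  \<open>F\<close> that vanishes at infinity.\<close>

lemma nn_integral_weight_plus:
  fixes y e :: real
  assumes "0 < y" "0 < e"
  shows "(\<integral>\<^sup>+t. ennreal (sqrt (y / (y + t)) / t) * indicator {e<..} t \<partial>lborel)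
         \<le> ennreal (2 * ln 2 + ln y - ln e + sqrt (e / y))"
proof -
  define F where "F t = ln (sqrt (y + t) - sqrt y) - ln (sqrt (y + t) + sqrt y)" for t
  have "(\<integral>\<^sup>+t. ennreal (sqrt (y / (y + t)) / t) * indicator (einterval e \<infinity>) t \<partial>lborel)
        = ennreal (0 - F e)"
  proof (rule nn_integral_FTC_einterval)
    show "((F \<circ> real_of_ereal) \<longlongrightarrow> F e) (at_right (ereal e))"
    proof -
      have "sqrt (y + e) > sqrt y" using assms by simp
      moreover have "sqrt (y + e) + sqrt y > 0" using assms by (simp add: add_pos_pos)
      ultimately have "isCont F e"
        unfolding F_def by (intro continuous_intros) auto
      then show ?thesis
        by (auto simp: ereal_tendsto_simps isCont_def filterlim_at_split)
    qed
    show "((F \<circ> real_of_ereal) \<longlongrightarrow> 0) (at_left \<infinity>)"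
      unfolding ereal_tendsto_simps F_def using assms by real_asymp
    fix t :: real assume "ereal e < ereal t"
    then have t: "0 < t" using assms by simp
    define s where "s = sqrt (y + t)"
    have s: "s > sqrt y" "s * s = y + t" "s > 0" using t assms by (simp_all add: s_def)
    have r: "sqrt y > 0" "sqrt y * sqrt y = y" using assms by auto
    have ds: "((\<lambda>t. sqrt (y + t)) has_real_derivative 1 / (2 * s)) (at t)"
      unfolding s_def using t assms
      by (auto intro!: derivative_eq_intros simp: inverse_eq_divide)
    have "DERIV F t :> 1 / (2 * s) / (s - sqrt y) - 1 / (2 * s) / (s + sqrt y)"
      using DERIV_diff[OF DERIV_ln_comp[OF DERIV_diff[OF ds DERIV_const[of "sqrt y"]]]
          DERIV_ln_comp[OF DERIV_add[OF ds DERIV_const[of "sqrt y"]]]] s r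
      by (simp add: F_def[abs_def] s_def[symmetric])
    also have "1 / (2 * s) / (s - sqrt y) - 1 / (2 * s) / (s + sqrt y) = sqrt y / (s * t)"
    proof -
      have "(s - sqrt y) * (s + sqrt y) = t" using s r by (simp add: algebra_simps)
      moreover have "1 / (2 * s) / (s - sqrt y) - 1 / (2 * s) / (s + sqrt y)
          = sqrt y / (s * ((s - sqrt y) * (s + sqrt y)))"
      proof -
        have "1 / (2 * s) / (s - q) - 1 / (2 * s) / (s + q) = q / (s * ((s - q) * (s + q)))"
          if "q < s" "0 < q" for q
          using that by (simp add: divide_simps)
        then show ?thesis using s r by blast
      qed
      ultimately show ?thesis by simp
    qed
    finally show "DERIV F t :> sqrt (y / (y + t)) / t"
      by (simp add: s_def real_sqrt_divide mult.commute)
    show "isCont (\<lambda>t. sqrt (y / (y + t)) / t) t"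
      using t assms by (intro continuous_intros) auto
    show "0 \<le> sqrt (y / (y + t)) / t" using t assms by simp
  qed simp
  also have "\<dots> \<le> ennreal (2 * ln 2 + ln y - ln e + sqrt (e / y))"
  proof (rule ennreal_leI)
    have "- F e \<le> 2 * ln 2 + ln y - ln e + sqrt (e / y)"
    proof -
      have r: "sqrt y > 0" "sqrt y * sqrt y = y" using assms by auto
      have gt: "sqrt (y + e) > sqrt y" using assms by simp
      have pos: "sqrt (y + e) + sqrt y > 0" using gt r by linarith
      \<comment> \<open>This product isolates the singular part \<open>ln e\<close> of
        \<open>F e\<close>; what remains is regular as \<open>e\<close> tends to 0.\<close>
      have "(sqrt (y + e) - sqrt y) * (sqrt (y + e) + sqrt y) = e"
        using assms by (simp add: algebra_simps)
      then have "ln e = ln (sqrt (y + e) - sqrt y) + ln (sqrt (y + e) + sqrt y)"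
        using gt pos by (metis diff_gt_0_iff_gt ln_mult_pos)
      then have "- F e = 2 * ln (sqrt (y + e) + sqrt y) - ln e" by (simp add: F_def)
      also have "sqrt (y + e) \<le> sqrt y + sqrt e" using assms by (intro sqrt_add_le_add_sqrt) auto
      then have "sqrt (y + e) + sqrt y \<le> 2 * sqrt y * (1 + sqrt (e / y) / 2)"
      proof -
        have "sqrt y * sqrt (e / y) = sqrt e" using assms by (simp add: real_sqrt_mult[symmetric])
        then have "2 * sqrt y * (1 + sqrt (e / y) / 2) = 2 * sqrt y + sqrt e" by (simp add: algebra_simps)
        with \<open>sqrt (y + e) \<le> sqrt y + sqrt e\<close> show ?thesis by linarith
      qed
      then have "ln (sqrt (y + e) + sqrt y) \<le> ln (2 * sqrt y * (1 + sqrt (e / y) / 2))"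
        using pos by (intro ln_mono) auto
      also have "\<dots> = ln 2 + ln y / 2 + ln (1 + sqrt (e / y) / 2)"
        
      proof -
        have "1 + sqrt (e / y) / 2 > 0" by (rule add_pos_nonneg) (use assms in auto)
        then show ?thesis using r by (simp add: ln_mult_pos ln_sqrt)
      qed
      also have "ln (1 + sqrt (e / y) / 2) \<le> sqrt (e / y) / 2"
        using assms by (intro ln_add_one_self_le_self) simp
      finally show ?thesis by simp
    qed
    then show "0 - F e \<le> 2 * ln 2 + ln y - ln e + sqrt (e / y)" by simp
  qed
  finally show ?thesis by simp
qed

text \<open>The same primitive with \<open>s = sqrt (y - t)\<close>; it vanishes at the singularity
  \<open>t = y\<close>. Since \<open>sqrt (y - e) \<le> sqrt y\<close>, no error term
  arises.\<close>

lemma nn_integral_weight_below: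
  fixes y e :: real
  assumes "0 < e" "e < y"
  shows "(\<integral>\<^sup>+t. ennreal (sqrt (y / \<bar>y - t\<bar>) / t) * indicator {e<..<y} t \<partial>lborel)
         \<le> ennreal (2 * ln 2 + ln y - ln e)"
proof -
  define F where "F t = ln (sqrt y - sqrt (y - t)) - ln (sqrt y + sqrt (y - t))" for t
  have y: "y > 0" using assms by simp
  have r: "sqrt y > 0" "sqrt y * sqrt y = y" using y by auto
  have "(\<integral>\<^sup>+t. ennreal (sqrt (y / \<bar>y - t\<bar>) / t) * indicator (einterval e y) t \<partial>lborel)
        = ennreal (0 - F e)"
  proof (rule nn_integral_FTC_einterval)
    have cont: "isCont F t" if "0 < t" "t \<le> y" for t
    proof -
      have "sqrt (y - t) < sqrt y" using that by simp
      moreover have "sqrt y + sqrt (y - t) > 0" using that r by (intro add_pos_nonneg) auto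
      ultimately show ?thesis
        unfolding F_def by (intro continuous_intros) auto
    qed
    show "((F \<circ> real_of_ereal) \<longlongrightarrow> F e) (at_right (ereal e))"
      using cont[of e] assms
      by (auto simp: ereal_tendsto_simps isCont_def filterlim_at_split)
    have "F y = 0" by (simp add: F_def)
    then show "((F \<circ> real_of_ereal) \<longlongrightarrow> 0) (at_left (ereal y))"
      using cont[of y] y
      by (auto simp: ereal_tendsto_simps isCont_def filterlim_at_split)
    fix t :: real assume "ereal e < ereal t" "ereal t < ereal y"
    then have t: "0 < t" "t < y" using assms by auto
    define s where "s = sqrt (y - t)"
    have s: "s < sqrt y" "s * s = y - t" "s > 0" using t assms by (simp_all add: s_def)
    have ds: "((\<lambda>t. sqrt (y - t)) has_real_derivative - (1 / (2 * s))) (at t)"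
      unfolding s_def using t assms
      by (auto intro!: derivative_eq_intros simp: inverse_eq_divide)
    have "DERIV F t :> 1 / (2 * s) / (sqrt y - s) + 1 / (2 * s) / (sqrt y + s)"
      using DERIV_diff[OF DERIV_ln_comp[OF DERIV_diff[OF DERIV_const[of "sqrt y"] ds]]
          DERIV_ln_comp[OF DERIV_add[OF DERIV_const[of "sqrt y"] ds]]] s r
      by (simp add: F_def[abs_def] s_def[symmetric])
    also have "1 / (2 * s) / (sqrt y - s) + 1 / (2 * s) / (sqrt y + s) = sqrt y / (s * t)"
    proof -
      have "(sqrt y - s) * (sqrt y + s) = t" using s r by (simp add: algebra_simps)
      moreover have "1 / (2 * s) / (sqrt y - s) + 1 / (2 * s) / (sqrt y + s)
          = sqrt y / (s * ((sqrt y - s) * (sqrt y + s)))"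
      proof -
        have "1 / (2 * s) / (q - s) + 1 / (2 * s) / (q + s) = q / (s * ((q - s) * (q + s)))"
          if "s < q" for q
          using that s(3) by (simp add: divide_simps)
        then show ?thesis using s by blast
      qed
      ultimately show ?thesis by simp
    qed
    finally show "DERIV F t :> sqrt (y / \<bar>y - t\<bar>) / t"
      using t by (simp add: s_def real_sqrt_divide mult.commute)
    show "isCont (\<lambda>t. sqrt (y / \<bar>y - t\<bar>) / t) t"
      using t assms by (intro continuous_intros) auto
    show "0 \<le> sqrt (y / \<bar>y - t\<bar>) / t" using t assms by simp
  qed (use assms in simp)
  also have "\<dots> \<le> ennreal (2 * ln 2 + ln y - ln e)"
  proof (rule ennreal_leI)
    have "- F e \<le> 2 * ln 2 + ln y - ln e"
    proof -
      have gt: "sqrt (y - e) < sqrt y" "sqrt (y - e) \<ge> 0" using assms by auto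
      have pos: "sqrt y + sqrt (y - e) > 0" by (rule add_pos_nonneg[OF r(1) gt(2)])
      have "(sqrt y - sqrt (y - e)) * (sqrt y + sqrt (y - e)) = e"
        using assms by (simp add: algebra_simps)
      then have "ln e = ln (sqrt y - sqrt (y - e)) + ln (sqrt y + sqrt (y - e))"
        using gt pos by (metis diff_gt_0_iff_gt ln_mult_pos)
      then have "- F e = 2 * ln (sqrt y + sqrt (y - e)) - ln e" by (simp add: F_def)
      also have "ln (sqrt y + sqrt (y - e)) \<le> ln (2 * sqrt y)"
        using pos gt r by (intro ln_mono) argo+
      also have "ln (2 * sqrt y) = ln 2 + ln y / 2"
        using y r by (simp add: ln_mult ln_sqrt)
      finally show ?thesis by simp
    qed
    then show "0 - F e \<le> 2 * ln 2 + ln y - ln e" by simp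
  qed
  finally show ?thesis by (simp add: einterval_eq)
qed

text \<open>Beyond the singularity the primitive is an arctangent, and the total mass is exactly
  \<open>pi\<close>. Averaged with the other sign of \<open>t\<close>, it becomes the
  \<open>pi / 2\<close> of the final constant.\<close>

lemma nn_integral_weight_above:
  fixes y :: real
  assumes "0 < y"
  shows "(\<integral>\<^sup>+t. ennreal (sqrt (y / \<bar>y - t\<bar>) / t) * indicator {y<..} t \<partial>lborel) = ennreal pi"
proof -
  define F where "F t = 2 * arctan (sqrt ((t - y) / y))" for t
  have "(\<integral>\<^sup>+t. ennreal (sqrt (y / \<bar>y - t\<bar>) / t) * indicator (einterval y \<infinity>) t \<partial>lborel)
        = ennreal (pi - 0)"
  proof (rule nn_integral_FTC_einterval)
    have "isCont F y" unfolding F_def using assms by (intro continuous_intros) auto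
    moreover have "F y = 0" by (simp add: F_def)
    ultimately show "((F \<circ> real_of_ereal) \<longlongrightarrow> 0) (at_right (ereal y))"
      by (auto simp: ereal_tendsto_simps isCont_def filterlim_at_split)
    show "((F \<circ> real_of_ereal) \<longlongrightarrow> pi) (at_left \<infinity>)"
      unfolding ereal_tendsto_simps F_def using assms by real_asymp
    fix t :: real assume "ereal y < ereal t"
    then have t: "y < t" by simp
    define s where "s = sqrt ((t - y) / y)"
    have s: "s > 0" "1 + s\<^sup>2 = t / y" using t assms by (simp_all add: s_def field_simps)
    have ds: "((\<lambda>t. sqrt ((t - y) / y)) has_real_derivative 1 / (2 * s) / y) (at t)"
    proof -
      have "((\<lambda>t. (t - y) / y) has_real_derivative 1 / y) (at t)"
        using assms by (auto intro!: derivative_eq_intros)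
      from DERIV_chain2[OF DERIV_real_sqrt this] show ?thesis
        using t assms by (simp add: s_def inverse_eq_divide mult.commute)
    qed
    have "DERIV F t :> 2 * (1 / (2 * s) / y / (1 + s\<^sup>2))"
      using DERIV_cmult[OF DERIV_chain2[OF DERIV_arctan ds], of 2]
      by (simp add: F_def[abs_def] s_def[symmetric] inverse_eq_divide ac_simps)
    also have "2 * (1 / (2 * s) / y / (1 + s\<^sup>2)) = 1 / s / t"
      unfolding s(2) using s(1) assms t by simp
    also have "1 / s = sqrt (y / \<bar>y - t\<bar>)" using t assms by (simp add: s_def real_sqrt_divide)
    finally show "DERIV F t :> sqrt (y / \<bar>y - t\<bar>) / t" .
    show "isCont (\<lambda>t. sqrt (y / \<bar>y - t\<bar>) / t) t"
      using t assms by (intro continuous_intros) auto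
    show "0 \<le> sqrt (y / \<bar>y - t\<bar>) / t" using t assms by simp
  qed simp
  then show ?thesis by simp
qed

text \<open>For \<open>e < y\<close> the range is split at the singularity \<open>t = y\<close>, a
  null set. Otherwise only the upper part is left, and \<open>2 * sqrt (e / y)\<close> outweighs
  \<open>ln e - ln y\<close>, so that the bound stays above \<open>pi\<close>.\<close>

lemma nn_integral_weight_minus:
  fixes y e :: real
  assumes "0 < y" "0 < e"
  shows "(\<integral>\<^sup>+t. ennreal (sqrt (y / \<bar>y - t\<bar>) / t) * indicator {e<..} t \<partial>lborel)
         \<le> ennreal (2 * ln 2 + ln y - ln e + pi + 2 * sqrt (e / y))"
proof (cases "e < y")
  case True
  have "(\<integral>\<^sup>+t. ennreal (sqrt (y / \<bar>y - t\<bar>) / t) * indicator {e<..} t \<partial>lborel)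
    \<le> (\<integral>\<^sup>+t. ennreal (sqrt (y / \<bar>y - t\<bar>) / t) * indicator {e<..<y} t
          + ennreal (sqrt (y / \<bar>y - t\<bar>) / t) * indicator {y<..} t \<partial>lborel)"
    using assms AE_lborel_singleton[of y]
    by (intro nn_integral_mono_AE) (auto elim!: eventually_mono simp: indicator_def)
  also have "\<dots> \<le> ennreal (2 * ln 2 + ln y - ln e) + ennreal pi"
    using nn_integral_weight_below[OF assms(2) True] nn_integral_weight_above[OF assms(1)]
    by (subst nn_integral_add) (auto intro!: add_mono)
  also have "\<dots> = ennreal (2 * ln 2 + ln y - ln e + pi)"
    using True assms by (intro ennreal_plus[symmetric]) (auto simp: add_increasing)
  also have "\<dots> \<le> ennreal (2 * ln 2 + ln y - ln e + pi + 2 * sqrt (e / y))"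
    using assms by (intro ennreal_leI) auto
  finally show ?thesis .
next
  case False
  have "(\<integral>\<^sup>+t. ennreal (sqrt (y / \<bar>y - t\<bar>) / t) * indicator {e<..} t \<partial>lborel)
    \<le> (\<integral>\<^sup>+t. ennreal (sqrt (y / \<bar>y - t\<bar>) / t) * indicator {y<..} t \<partial>lborel)"
    using False by (intro nn_integral_mono) (auto simp: indicator_def)
  also have "\<dots> = ennreal pi" by (rule nn_integral_weight_above[OF assms(1)])
  also have "\<dots> \<le> ennreal (2 * ln 2 + ln y - ln e + pi + 2 * sqrt (e / y))"
  proof (intro ennreal_leI)
    have "ln (sqrt (e / y)) \<le> sqrt (e / y) - 1" by (rule ln_le_minus_one) (use assms in simp)
    then have "ln e - ln y \<le> 2 * sqrt (e / y) - 2" using assms by (simp add: ln_sqrt ln_div)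
    moreover have "ln 2 \<ge> (0::real)" by simp
    ultimately show "pi \<le> 2 * ln 2 + ln y - ln e + pi + 2 * sqrt (e / y)" by linarith
  qed
  finally show ?thesis .
qed

text \<open>The tangent of the logarithm of \<open>sqrt z\<close> at \<open>sqrt z = 2\<close>. With
  \<open>z = e / y\<close> it shows that the weight bounds are nonnegative, so nothing is truncated
  by \<open>ennreal\<close>.\<close>

lemma ln_le_sqrt:
  fixes z :: real
  assumes "0 < z" shows "ln z \<le> sqrt z + 2 * ln 2 - 2"
proof -
  have "ln (sqrt z / 2) \<le> sqrt z / 2 - 1" by (rule ln_le_minus_one) (use assms in simp)
  moreover have "ln (sqrt z / 2) = ln z / 2 - ln 2" using assms by (simp add: ln_sqrt ln_div)
  ultimately show ?thesis by argo
qed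

text \<open>With \<open>y = \<bar>x\<bar>\<close> and \<open>t > 0\<close>, the numbers
  \<open>\<bar>x + t\<bar>\<close> and \<open>\<bar>x - t\<bar>\<close> are \<open>y + t\<close> and
  \<open>\<bar>y - t\<bar>\<close> in some order, so the result is the mean of the two one-sided
  bounds; their errors 1 and 2 average to \<open>3 / 2\<close>.\<close>

lemma nn_integral_weight:
  fixes x e :: real
  assumes "x \<noteq> 0" "0 < e"
  shows "(\<integral>\<^sup>+t. ennreal ((sqrt (\<bar>x\<bar> / \<bar>x + t\<bar>) + sqrt (\<bar>x\<bar> / \<bar>x - t\<bar>)) / (2 * t)) * indicator {e<..} t \<partial>lborel)
         \<le> ennreal (2 * ln 2 + pi / 2 + ln \<bar>x\<bar> - ln e + 3 / 2 * sqrt (e / \<bar>x\<bar>))"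
proof -
  define y where "y = \<bar>x\<bar>"
  have y: "y > 0" using assms by (simp add: y_def)
  let ?p = "\<lambda>t. ennreal (sqrt (y / (y + t)) / t) * indicator {e<..} t"
  let ?m = "\<lambda>t. ennreal (sqrt (y / \<bar>y - t\<bar>) / t) * indicator {e<..} t"
  have sum: "sqrt (\<bar>x\<bar> / \<bar>x + t\<bar>) + sqrt (\<bar>x\<bar> / \<bar>x - t\<bar>) = sqrt (y / (y + t)) + sqrt (y / \<bar>y - t\<bar>)"
    if "t > 0" for t
    proof (cases "x > 0")
    case False
    then have "\<bar>x + t\<bar> = \<bar>y - t\<bar>" "\<bar>x - t\<bar> = y + t" using that by (auto simp: y_def)
    then show ?thesis by (simp add: y_def)
  qed (use that in \<open>simp add: y_def\<close>)
  have "ennreal ((sqrt (\<bar>x\<bar> / \<bar>x + t\<bar>) + sqrt (\<bar>x\<bar> / \<bar>x - t\<bar>)) / (2 * t)) * indicator {e<..} t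
      = ennreal (1/2) * (?p t + ?m t)" for t
  proof (cases "t > e")
    case True
    then have t: "t > 0" using assms by simp
    have "(sqrt (\<bar>x\<bar> / \<bar>x + t\<bar>) + sqrt (\<bar>x\<bar> / \<bar>x - t\<bar>)) / (2 * t)
        = 1/2 * (sqrt (y / (y + t)) / t + sqrt (y / \<bar>y - t\<bar>) / t)" (is "?l = 1/2 * (?A + ?B)")
      unfolding sum[OF t] by (simp add: add_divide_distrib)
    then have "ennreal ?l = ennreal (1/2 * (?A + ?B))" by (rule arg_cong)
    also have "\<dots> = ennreal (1/2) * (ennreal ?A + ennreal ?B)"
    proof -
      have "0 \<le> ?A" "0 \<le> ?B" using t y by auto
      then show ?thesis by (subst ennreal_mult') simp_all
    qed
    finally show ?thesis using True by simp
  qed simp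
  note eq = this
  have "(\<integral>\<^sup>+t. ennreal ((sqrt (\<bar>x\<bar> / \<bar>x + t\<bar>) + sqrt (\<bar>x\<bar> / \<bar>x - t\<bar>)) / (2 * t)) * indicator {e<..} t \<partial>lborel)
     = ennreal (1/2) * ((\<integral>\<^sup>+t. ?p t \<partial>lborel) + (\<integral>\<^sup>+t. ?m t \<partial>lborel))"
    by (subst nn_integral_cong[OF eq], subst nn_integral_cmult, measurable, subst nn_integral_add, simp_all)
  also have "\<dots> \<le> ennreal (1/2) * (ennreal (2 * ln 2 + ln y - ln e + sqrt (e / y))
       + ennreal (2 * ln 2 + ln y - ln e + pi + 2 * sqrt (e / y)))"
    by (intro mult_left_mono add_mono nn_integral_weight_plus nn_integral_weight_minus y assms) simp
  also have "\<dots> = ennreal (1/2 * ((2 * ln 2 + ln y - ln e + sqrt (e / y))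
       + (2 * ln 2 + ln y - ln e + pi + 2 * sqrt (e / y))))"
  proof -
    have "ln e - ln y \<le> sqrt (e / y) + 2 * ln 2 - 2"
      using ln_le_sqrt[of "e / y"] assms y by (simp add: ln_div)
    then have nn1: "0 \<le> 2 * ln 2 + ln y - ln e + sqrt (e / y)" by argo
    moreover have "sqrt (e / y) \<ge> 0" using assms y by simp
    ultimately have "0 \<le> 2 * ln 2 + ln y - ln e + pi + 2 * sqrt (e / y)"
      using pi_gt_zero by linarith
    moreover have "ennreal (1/2) * (ennreal A + ennreal B) = ennreal (1/2 * (A + B))"
      if "0 \<le> A" "0 \<le> B" for A B
      using that by (simp only: ennreal_plus[symmetric]) (subst ennreal_mult', simp_all)
    ultimately show ?thesis using nn1 by blast
  qed
  also have "\<dots> = ennreal (2 * ln 2 + pi / 2 + ln \<bar>x\<bar> - ln e + 3 / 2 * sqrt (e / \<bar>x\<bar>))"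
    unfolding y_def[symmetric] by (rule arg_cong[of _ _ ennreal]) argo
  finally show ?thesis .
qed

section \<open>Fourier inversion for decaying functions\<close>

lemma borel_measurable_cis [measurable]: "cis \<in> borel_measurable borel"
  by (intro borel_measurable_continuous_onI continuous_intros)

text \<open>Justifies every Fubini exchange of Bochner integrals below: the tensor product of two
  integrable functions dominates. The type is generic because the kernel is \<open>cis\<close> in
  some uses and a real cosine in another.\<close>

lemma integrable_bounded_kernel:
  fixes f g :: "real \<Rightarrow> 'a::{real_normed_field, banach, second_countable_topology}"
  assumes f: "integrable lborel f" and g: "integrable lborel g"
    and [measurable]: "case_prod k \<in> borel_measurable (lborel \<Otimes>\<^sub>M lborel)"
    and k: "\<And>x y. norm (k x y) \<le> 1"
  shows "integrable (lborel \<Otimes>\<^sub>M lborel) (\<lambda>(x, y). f x * g y * k x y)"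
proof -
  have [measurable]: "f \<in> borel_measurable borel" "g \<in> borel_measurable borel"
    using f g by (auto dest: borel_measurable_integrable)
  have "integrable (lborel \<Otimes>\<^sub>M lborel) (\<lambda>(x, y). f x * g y)"
  proof (rule lborel_pair.Fubini_integrable)
    show "integrable lborel (\<lambda>x. LBINT y. norm (case (x, y) of (x, y) \<Rightarrow> f x * g y))"
      using f by (simp add: norm_mult)
    show "AE x in lborel. integrable lborel (\<lambda>y. case (x, y) of (x, y) \<Rightarrow> f x * g y)"
      using g by simp
  qed measurable
  then show ?thesis
    by (rule Bochner_Integration.integrable_bound) (auto simp: norm_mult k mult_left_le)
qed

lemmas Fubini_bounded_kernel = lborel_pair.Fubini_integral[OF integrable_bounded_kernel]

section \<open>Functions of quadratic decay and their Fourier transforms\<close>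

lemma integrable_inverse_plus_square: "integrable lborel (\<lambda>x::real. C / (1 + x\<^sup>2))"
proof -
  have "integrable lborel (\<lambda>x::real. inverse (1 + x\<^sup>2))"
    using integrable_inverse_1_plus_square by (simp add: set_integrable_def einterval_def)
  from integrable_mult_right[OF this, of C] show ?thesis by (simp add: divide_inverse)
qed

text \<open>Quadratic decay is what two integrable derivatives of a function give for its Fourier
  transform, so a function and its transform can both lie in this class.\<close>

definition decaying :: "(real \<Rightarrow> complex) \<Rightarrow> bool" where
  "decaying g \<longleftrightarrow> continuous_on UNIV g \<and> (\<exists>C. \<forall>x. norm (g x) \<le> C / (1 + x\<^sup>2))"

lemma decayingE:
  assumes "decaying g"
  obtains C where "C > 0" "\<And>x. norm (g x) \<le> C / (1 + x\<^sup>2)" "\<And>x. norm (g x) \<le> C"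
proof -
  from assms obtain C where C: "\<And>x. norm (g x) \<le> C / (1 + x\<^sup>2)" by (auto simp: decaying_def)
  have "norm (g x) \<le> (\<bar>C\<bar> + 1) / (1 + x\<^sup>2)" for x
    by (rule order_trans[OF C]) (auto intro!: divide_right_mono)
  moreover have "(\<bar>C\<bar> + 1) / (1 + x\<^sup>2) \<le> \<bar>C\<bar> + 1" for x
    by (simp add: field_simps add_pos_nonneg)
  ultimately show thesis using that[of "\<bar>C\<bar> + 1"] by (meson abs_ge_zero add_nonneg_pos order_trans zero_less_one)
qed

lemma decaying_continuous: "decaying g \<Longrightarrow> continuous_on UNIV g"
  by (simp add: decaying_def)

lemma decaying_isCont: "decaying g \<Longrightarrow> isCont g x"
  by (simp add: decaying_def continuous_on_eq_continuous_at)

lemma decaying_measurable: "decaying g \<Longrightarrow> g \<in> borel_measurable borel"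
  by (intro borel_measurable_continuous_onI decaying_continuous)

lemma decaying_integrable:
  assumes "decaying g" shows "integrable lborel g"
proof -
  from assms obtain C where C: "\<And>x. norm (g x) \<le> C / (1 + x\<^sup>2)" by (rule decayingE) blast
  show ?thesis
  proof (rule Bochner_Integration.integrable_bound[OF integrable_inverse_plus_square[of C]])
    show "AE x in lborel. norm (g x) \<le> norm (C / (1 + x\<^sup>2))"
      using C order_trans[OF C abs_ge_self] by simp
  qed (use decaying_measurable[OF assms] in simp)
qed

lemma decaying_tendsto_zero:
  assumes "decaying g" shows "(g \<longlongrightarrow> 0) at_top" "(g \<longlongrightarrow> 0) at_bot"
proof -
  from assms obtain C where C: "C > 0" "\<And>x. norm (g x) \<le> C / (1 + x\<^sup>2)" by (rule decayingE) blast
  show "(g \<longlongrightarrow> 0) at_top"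
    by (rule Lim_null_comparison[of _ "\<lambda>x. C / (1 + x\<^sup>2)"]) (simp add: C, real_asymp)
  show "(g \<longlongrightarrow> 0) at_bot"
    by (rule Lim_null_comparison[of _ "\<lambda>x. C / (1 + x\<^sup>2)"]) (simp add: C, real_asymp)
qed

text \<open>The unitary normalisation: the inversion formula carries the same factor, and Plancherel
  carries none.\<close>

definition fourier :: "(real \<Rightarrow> complex) \<Rightarrow> real \<Rightarrow> complex" where
  "fourier h v = (LBINT x. h x * cis (- (v * x))) / sqrt (2 * pi)"

lemma integrable_mult_cis:
  fixes h :: "real \<Rightarrow> complex"
  assumes "integrable lborel h" "\<phi> \<in> borel_measurable borel"
  shows "integrable lborel (\<lambda>x. h x * cis (\<phi> x))"
proof -
  have "h \<in> borel_measurable borel" using assms(1) by auto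
  then show ?thesis
    by (intro Bochner_Integration.integrable_bound[OF assms(1)])
       (use assms(2) in \<open>auto simp: norm_mult\<close>)
qed

lemma fourier_continuous:
  assumes "integrable lborel h" shows "continuous_on UNIV (fourier h)"
proof -
  have [measurable]: "h \<in> borel_measurable borel" using assms by auto
  have "((\<lambda>v. LBINT x. h x * cis (- (v * x))) \<longlongrightarrow> (LBINT x. h x * cis (- (w * x)))) (at w)" for w
  proof (rule tendsto_at_iff_sequentially[THEN iffD2], clarify)
    fix X :: "nat \<Rightarrow> real" assume X: "X \<longlonglongrightarrow> w"
    show "((\<lambda>v. LBINT x. h x * cis (- (v * x))) \<circ> X) \<longlonglongrightarrow> (LBINT x. h x * cis (- (w * x)))"
      unfolding o_def
    proof (rule integral_dominated_convergence)
      show "integrable lborel (\<lambda>x. norm (h x))" using assms by simp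
      show "AE x in lborel. (\<lambda>n. h x * cis (- (X n * x))) \<longlonglongrightarrow> h x * cis (- (w * x))"
        using X by (auto simp: cis_conv_exp intro!: tendsto_intros)
    qed (auto simp: norm_mult)
  qed
  then have "isCont (\<lambda>v. LBINT x. h x * cis (- (v * x))) w" for w by (simp add: isCont_def)
  then show ?thesis
    unfolding fourier_def[abs_def]
    by (intro continuous_intros) (auto intro: continuous_at_imp_continuous_on)
qed

text \<open>Integration by parts: the derivative of \<open>h x * cis (- (v * x))\<close> integrates
  to 0 because \<open>h\<close> vanishes at both ends.\<close>

lemma fourier_deriv:
  assumes h: "decaying h" "decaying h'" and d: "\<And>x. (h has_vector_derivative h' x) (at x)"
  shows "fourier h' v = \<i> * v * fourier h v"
proof -
  let ?u = "\<lambda>x. h x * cis (- (v * x))"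
  let ?u' = "\<lambda>x. h' x * cis (- (v * x)) - \<i> * v * (h x * cis (- (v * x)))"
  have int: "integrable lborel (\<lambda>x. h x * cis (- (v * x)))" "integrable lborel (\<lambda>x. h' x * cis (- (v * x)))"
    using h by (auto intro!: integrable_mult_cis dest: decaying_integrable)
  have dcis: "((\<lambda>x. cis (- (v * x))) has_vector_derivative - (\<i> * v * cis (- (v * x)))) (at x)" for x
    unfolding has_vector_derivative_def
    by (auto intro!: derivative_eq_intros simp: scaleR_conv_of_real mult_ac)
  have lim: "(?u \<longlongrightarrow> 0) F" if "(h \<longlongrightarrow> 0) F" for F
    using tendsto_norm_zero[OF that]
    by (intro tendsto_norm_zero_cancel[of ?u]) (simp add: norm_mult)
  have "(LBINT x=-\<infinity>..\<infinity>. ?u' x) = 0 - 0"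
  proof (rule interval_integral_FTC_integrable[where F = ?u])
    show "(?u has_vector_derivative ?u' x) (at x)" for x
      by (rule has_vector_derivative_eq_rhs[OF has_vector_derivative_mult[OF d dcis]])
         (simp add: algebra_simps)
    show "isCont ?u' x" for x
      using decaying_isCont[OF h(1)] decaying_isCont[OF h(2)]
      by (auto intro!: continuous_intros simp: cis_conv_exp)
    show "set_integrable lborel (einterval (- \<infinity>) \<infinity>) ?u'"
      using int by (simp add: set_integrable_def einterval_def)
    show "((?u \<circ> real_of_ereal) \<longlongrightarrow> 0) (at_right (- \<infinity>))"
      unfolding ereal_tendsto_simps by (rule lim[OF decaying_tendsto_zero(2)[OF h(1)]])
    show "((?u \<circ> real_of_ereal) \<longlongrightarrow> 0) (at_left \<infinity>)"
      unfolding ereal_tendsto_simps by (rule lim[OF decaying_tendsto_zero(1)[OF h(1)]])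
  qed simp
  then have "(LBINT x. ?u' x) = 0"
    by (simp add: interval_lebesgue_integral_def set_lebesgue_integral_def einterval_def)
  then show ?thesis using int by (simp add: fourier_def)
qed

lemma norm_fourier_le: "norm (fourier h v) \<le> (LBINT x. norm (h x)) / sqrt (2 * pi)"
proof -
  have "norm (LBINT x. h x * cis (- (v * x))) \<le> (LBINT x. norm (h x * cis (- (v * x))))"
    by (rule integral_norm_bound)
  then show ?thesis by (simp add: fourier_def norm_divide norm_mult divide_right_mono)
qed

text \<open>Two derivatives turn into the factor \<open>- v\<^sup>2\<close>, so
  \<open>v\<^sup>2 * fourier h v\<close> is bounded by the integral of \<open>norm (h2 x)\<close>;
  adding the trivial bound for \<open>fourier h\<close> itself gives quadratic decay.\<close>

lemma decaying_fourier:
  assumes "decaying h" "decaying h1" "decaying h2"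
    and "\<And>x. (h has_vector_derivative h1 x) (at x)"
    and "\<And>x. (h1 has_vector_derivative h2 x) (at x)"
  shows "decaying (fourier h)"
proof -
  define A where "A = (LBINT x. norm (h x)) / sqrt (2 * pi)"
  define B where "B = (LBINT x. norm (h2 x)) / sqrt (2 * pi)"
  have "norm (fourier h v) \<le> (A + B) / (1 + v\<^sup>2)" for v
  proof -
    have "fourier h2 v = - (v\<^sup>2 * fourier h v)"
      using fourier_deriv[OF assms(2,3,5)] fourier_deriv[OF assms(1,2,4)]
      by (simp add: power2_eq_square mult_ac)
    then have "v\<^sup>2 * norm (fourier h v) = norm (fourier h2 v)"
      by (simp add: norm_mult norm_power)
    also have "\<dots> \<le> B" unfolding B_def by (rule norm_fourier_le)
    finally have "(1 + v\<^sup>2) * norm (fourier h v) \<le> A + B"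
      using norm_fourier_le[of h v] by (simp add: A_def algebra_simps)
    then show ?thesis by (simp add: field_simps add_pos_nonneg)
  qed
  then show ?thesis
    unfolding decaying_def using fourier_continuous[OF decaying_integrable[OF assms(1)]] by blast
qed

section \<open>Gaussian summation, inversion and correlation\<close>

lemma std_normal_density_fourier:
  "(LBINT w. std_normal_density w *\<^sub>R cis (z * w)) = sqrt (2 * pi) * std_normal_density z"
proof -
  have "(LBINT w. std_normal_density w *\<^sub>R cis (z * w)) = char std_normal_distribution z"
    unfolding char_def by (subst integral_density) (auto simp: cis_conv_exp normal_density_nonneg)
  also have "\<dots> = sqrt (2 * pi) * std_normal_density z"
    unfolding char_std_normal_distribution by (simp add: std_normal_density_def)
  finally show ?thesis .
qed

text \<open>The Gaussian factor makes the inversion integral absolutely convergent as a double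
  integral. After Fubini, the transform of the Gaussian turns it into a mean of \<open>h\<close>
  around \<open>x\<close> at scale \<epsilon>.\<close>

lemma fourier_gauss_mean:
  fixes \<epsilon> :: real
  assumes h: "decaying h" "integrable lborel (fourier h)" and e: "\<epsilon> > 0"
  shows "(LBINT v. fourier h v * cis (x * v) * std_normal_density (\<epsilon> * v))
         = (LBINT w. h (x - \<epsilon> * w) * std_normal_density w)"
proof -
  let ?g = "\<lambda>v. complex_of_real (std_normal_density (\<epsilon> * v))"
  have gi: "integrable lborel ?g"
    using lborel_integrable_real_affine[of std_normal_density \<epsilon> 0] e
    by (simp add: integrable_normal_density)
  have [measurable]: "h \<in> borel_measurable borel" using h(1) by (rule decaying_measurable)
  have scale: "(LBINT v. ?g v * cis (z * v)) = sqrt (2 * pi) * std_normal_density (z / \<epsilon>) / \<epsilon>" for z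
  proof -
    have "(LBINT w. std_normal_density w *\<^sub>R cis (z / \<epsilon> * w))
        = \<epsilon> *\<^sub>R (LBINT v. std_normal_density (0 + \<epsilon> * v) *\<^sub>R cis (z / \<epsilon> * (0 + \<epsilon> * v)))"
      using lborel_integral_real_affine[of \<epsilon> "\<lambda>w. std_normal_density w *\<^sub>R cis (z / \<epsilon> * w)" 0] e by simp
    then show ?thesis
      using e unfolding std_normal_density_fourier by (simp add: scaleR_conv_of_real field_simps)
  qed
  have "(LBINT v. fourier h v * cis (x * v) * ?g v)
      = (LBINT v. (LBINT y. h y * ?g v * cis ((x - y) * v))) / sqrt (2 * pi)"
  proof -
    have "fourier h v * cis (x * v) * ?g v
        = (LBINT y. h y * ?g v * cis ((x - y) * v)) / sqrt (2 * pi)" for v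
    proof -
      have "(LBINT y. h y * ?g v * cis ((x - y) * v))
          = (LBINT y. h y * cis (- (v * y)) * (?g v * cis (x * v)))"
      proof (intro Bochner_Integration.integral_cong refl)
        fix y
        have "cis ((x - y) * v) = cis (- (v * y)) * cis (x * v)" by (simp add: cis_mult algebra_simps)
        then show "h y * ?g v * cis ((x - y) * v) = h y * cis (- (v * y)) * (?g v * cis (x * v))" by simp
      qed
      then show ?thesis by (simp only: fourier_def integral_mult_left_zero) (simp add: mult_ac)
    qed
    then show ?thesis by simp
  qed
  also have "(LBINT v. (LBINT y. h y * ?g v * cis ((x - y) * v)))
      = (LBINT y. (LBINT v. h y * ?g v * cis ((x - y) * v)))"
    by (rule Fubini_bounded_kernel[OF decaying_integrable[OF h(1)] gi]) auto
  also have "\<dots> = (LBINT y. h y * (sqrt (2 * pi) * std_normal_density ((x - y) / \<epsilon>) / \<epsilon>))"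
    by (simp add: mult.assoc scale)
  \<comment> \<open>Substituting \<open>y = x - \<epsilon> * w\<close> moves the scale from the
    Gaussian into the argument of \<open>h\<close>.\<close>
  also have "\<dots> = \<bar>- \<epsilon>\<bar> *\<^sub>R (LBINT w. h (x + - \<epsilon> * w) * (sqrt (2 * pi) * std_normal_density ((x - (x + - \<epsilon> * w)) / \<epsilon>) / \<epsilon>))"
    by (rule lborel_integral_real_affine) (use e in simp)
  also have "\<dots> = sqrt (2 * pi) * (LBINT w. h (x - \<epsilon> * w) * std_normal_density w)"
  proof -
    have "(LBINT w. h (x + - \<epsilon> * w) * (sqrt (2 * pi) * std_normal_density ((x - (x + - \<epsilon> * w)) / \<epsilon>) / \<epsilon>))
       = (LBINT w. (sqrt (2 * pi) / \<epsilon>) * (h (x - \<epsilon> * w) * std_normal_density w))"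
      using e by (intro Bochner_Integration.integral_cong) auto
    then show ?thesis using e by (simp add: scaleR_conv_of_real)
  qed
  finally show ?thesis by simp
qed

text \<open>Lets the scale of the Gaussian mean tend to 0 along \<open>1 / (n + 1)\<close>.
  Dominated convergence applies on both sides, with majorants \<open>norm (fourier h v)\<close> and
  a constant times the normal density; the value \<open>1 / sqrt (2 * pi)\<close> of the density at
  0 supplies the factor.\<close>

lemma fourier_inversion:
  assumes h: "decaying h" "decaying (fourier h)"
  shows "h x = (LBINT v. fourier h v * cis (x * v)) / sqrt (2 * pi)"
proof -
  let ?e = "\<lambda>n. inverse (real (Suc n))"
  have e: "?e \<longlonglongrightarrow> 0" by (rule LIMSEQ_inverse_real_of_nat)
  have [measurable]: "h \<in> borel_measurable borel" "fourier h \<in> borel_measurable borel"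
    using h by (auto intro: decaying_measurable)
  have d0: "std_normal_density 0 = 1 / sqrt (2 * pi)" by (simp add: std_normal_density_def)
  have dle: "std_normal_density w \<le> 1" for w
  proof -
    have "std_normal_density w \<le> 1 / sqrt (2 * pi) * 1"
      unfolding std_normal_density_def by (intro mult_left_mono) auto
    also have "\<dots> \<le> 1" using pi_gt3 by (simp add: real_le_rsqrt)
    finally show ?thesis .
  qed
  obtain C where C: "\<And>x. norm (h x) \<le> C" using decayingE[OF h(1)] by blast
  have "(\<lambda>n. LBINT v. fourier h v * cis (x * v) * std_normal_density (?e n * v))
      \<longlonglongrightarrow> (LBINT v. fourier h v * cis (x * v) * std_normal_density 0)"
  proof (rule integral_dominated_convergence)
    show "integrable lborel (\<lambda>v. norm (fourier h v))" using decaying_integrable[OF h(2)] by simp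
    show "AE v in lborel. (\<lambda>n. fourier h v * cis (x * v) * std_normal_density (?e n * v))
      \<longlonglongrightarrow> fourier h v * cis (x * v) * std_normal_density 0"
    proof (rule AE_I2)
      fix v
      have "(\<lambda>n. std_normal_density (?e n * v)) \<longlonglongrightarrow> std_normal_density (0 * v)"
        unfolding std_normal_density_def by (intro tendsto_intros e) auto
      then show "(\<lambda>n. fourier h v * cis (x * v) * std_normal_density (?e n * v))
        \<longlonglongrightarrow> fourier h v * cis (x * v) * std_normal_density 0"
        by (intro tendsto_intros) simp
    qed
    show "AE v in lborel. norm (fourier h v * cis (x * v) * std_normal_density (?e n * v)) \<le> norm (fourier h v)" for n
      using dle by (auto simp: norm_mult mult_left_le normal_density_nonneg simp del: of_nat_Suc)
  qed measurable
  moreover have "(\<lambda>n. LBINT w. h (x - ?e n * w) * std_normal_density w)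
      \<longlonglongrightarrow> (LBINT w. h x * std_normal_density w)"
  proof (rule integral_dominated_convergence)
    show "integrable lborel (\<lambda>w. C * std_normal_density w)" by (simp add: integrable_normal_density)
    show "AE w in lborel. (\<lambda>n. h (x - ?e n * w) * std_normal_density w) \<longlonglongrightarrow> h x * std_normal_density w"
    proof (rule AE_I2)
      fix w
      have "(\<lambda>n. x - ?e n * w) \<longlonglongrightarrow> x - 0 * w" by (intro tendsto_intros e)
      then have "(\<lambda>n. h (x - ?e n * w)) \<longlonglongrightarrow> h x"
        using isCont_tendsto_compose[OF decaying_isCont[OF h(1)]] by simp
      then show "(\<lambda>n. h (x - ?e n * w) * std_normal_density w) \<longlonglongrightarrow> h x * std_normal_density w"
        by (intro tendsto_intros)
    qed
    show "AE w in lborel. norm (h (x - ?e n * w) * std_normal_density w) \<le> C * std_normal_density w" for n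
      using C by (auto simp: norm_mult normal_density_nonneg intro!: mult_right_mono)
  qed measurable
  moreover have "(LBINT v. fourier h v * cis (x * v) * std_normal_density (?e n * v))
         = (LBINT w. h (x - ?e n * w) * std_normal_density w)" for n
    using fourier_gauss_mean[OF h(1) decaying_integrable[OF h(2)]] by simp
  ultimately have "(LBINT v. fourier h v * cis (x * v) * std_normal_density 0) = (LBINT w. h x * std_normal_density w)"
    by (simp only:) (rule LIMSEQ_unique)
  then show ?thesis by (simp add: d0 integral_normal_density)
qed

text \<open>The Wiener-Khinchin identity. The inversion formula is inserted for
  \<open>h (x + t)\<close>; after Fubini the integral over \<open>x\<close> is the conjugate of the
  Fourier integral.\<close>

lemma fourier_correlation:
  assumes h: "decaying h" "decaying (fourier h)"
  shows "(LBINT x. h (x + t) * cnj (h x)) = (LBINT v. (norm (fourier h v))\<^sup>2 * cis (t * v))"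
proof -
  have [measurable]: "h \<in> borel_measurable borel" "fourier h \<in> borel_measurable borel"
    using h by (auto intro: decaying_measurable)
  have hc: "integrable lborel (\<lambda>x. cnj (h x))" using decaying_integrable[OF h(1)] by simp
  have inner: "(LBINT x. fourier h v * cnj (h x) * cis ((x + t) * v))
      = sqrt (2 * pi) * ((norm (fourier h v))\<^sup>2 * cis (t * v))" for v
  proof -
    have "(LBINT x. fourier h v * cnj (h x) * cis ((x + t) * v))
        = (LBINT x. fourier h v * cis (t * v) * cnj (h x * cis (- (v * x))))"
    proof (intro Bochner_Integration.integral_cong refl)
      fix x
      have "cis ((x + t) * v) = cis (t * v) * cis (v * x)" by (simp add: cis_mult algebra_simps)
      then show "fourier h v * cnj (h x) * cis ((x + t) * v)
          = fourier h v * cis (t * v) * cnj (h x * cis (- (v * x)))" by (simp add: cis_cnj)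
    qed
    also have "\<dots> = fourier h v * cis (t * v) * cnj (LBINT x. h x * cis (- (v * x)))"
      by (simp only: integral_mult_right_zero Bochner_Integration.integral_cnj)
    also have "cnj (LBINT x. h x * cis (- (v * x))) = sqrt (2 * pi) * cnj (fourier h v)"
      by (simp add: fourier_def)
    finally show ?thesis by (simp only: complex_norm_square mult_ac)
  qed
  have "h (x + t) * cnj (h x)
      = (LBINT v. fourier h v * cnj (h x) * cis ((x + t) * v)) / sqrt (2 * pi)" for x
    by (subst fourier_inversion[OF h]) (simp add: mult_ac)
  then have "(LBINT x. h (x + t) * cnj (h x))
      = (LBINT x. (LBINT v. fourier h v * cnj (h x) * cis ((x + t) * v))) / sqrt (2 * pi)"
    by simp
  also have "(LBINT x. (LBINT v. fourier h v * cnj (h x) * cis ((x + t) * v)))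
      = (LBINT v. (LBINT x. fourier h v * cnj (h x) * cis ((x + t) * v)))"
    by (rule Fubini_bounded_kernel[OF decaying_integrable[OF h(2)] hc]) auto
  also have "\<dots> = (LBINT v. sqrt (2 * pi) * ((norm (fourier h v))\<^sup>2 * cis (t * v)))"
    by (simp only: inner)
  finally show ?thesis by simp
qed

section \<open>The logarithmic uncertainty principle\<close>

lemma
  fixes u v w :: "'a \<Rightarrow> real"
  assumes "integrable M u" "integrable M v" "integrable M w"
  shows integrable_lincomb3: "integrable M (\<lambda>x. a * u x + b * v x + c * w x)"
    and integral_lincomb3: "integral\<^sup>L M (\<lambda>x. a * u x + b * v x + c * w x)
      = a * integral\<^sup>L M u + b * integral\<^sup>L M v + c * integral\<^sup>L M w"
  using assms by simp_all

text \<open>A nonintegrable function has Bochner integral 0, so the bound is then trivial. It lets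
  the correlation estimate pass to nonnegative integrals at once.\<close>

lemma ennreal_integral_le_nn_integral:
  fixes f :: "'a \<Rightarrow> real"
  shows "ennreal (integral\<^sup>L M f) \<le> (\<integral>\<^sup>+x. ennreal (f x) \<partial>M)"
proof (cases "integrable M f")
  case True
  have "ennreal (integral\<^sup>L M f) \<le> ennreal (enn2real (\<integral>\<^sup>+x. ennreal (f x) \<partial>M))"
    unfolding real_lebesgue_integral_def[OF True] by (intro ennreal_leI) simp
  also have "\<dots> \<le> (\<integral>\<^sup>+x. ennreal (f x) \<partial>M)" by (simp add: ennreal_enn2real_if)
  finally show ?thesis .
qed (simp add: not_integrable_integral_eq)

lemma ennreal_norm_integral_le_nn_integral:
  fixes f :: "'a \<Rightarrow> 'b::{banach, second_countable_topology}"
  shows "ennreal (norm (integral\<^sup>L M f)) \<le> (\<integral>\<^sup>+x. ennreal (norm (f x)) \<partial>M)"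
  by (cases "integrable M f") (simp_all add: integral_norm_bound_ennreal not_integrable_integral_eq)

text \<open>The common majorant for both weighted moments. On the positive half-line a primitive is
  \<open>2 * arctan (sqrt x)\<close>; reflection gives the other half.\<close>

lemma integrable_inverse_sqrt_weight: "integrable lborel (\<lambda>x::real. 1 / (sqrt \<bar>x\<bar> * (1 + \<bar>x\<bar>)))"
proof -
  let ?g = "\<lambda>x::real. indicator {0<..} x *\<^sub>R (1 / (sqrt \<bar>x\<bar> * (1 + \<bar>x\<bar>)))"
  have "set_integrable lborel (einterval 0 \<infinity>) (\<lambda>x::real. 1 / (sqrt \<bar>x\<bar> * (1 + \<bar>x\<bar>)))"
  proof (rule interval_integral_FTC_nonneg(1)[where F = "\<lambda>x. 2 * arctan (sqrt x)" and A = 0 and B = pi])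
    fix x :: real assume "(0::ereal) < ereal x"
    then have x: "x > 0" by simp
    show "DERIV (\<lambda>x. 2 * arctan (sqrt x)) x :> 1 / (sqrt \<bar>x\<bar> * (1 + \<bar>x\<bar>))"
      by (rule DERIV_cong[OF DERIV_cmult[OF DERIV_chain2[OF DERIV_arctan DERIV_real_sqrt[OF x]], of 2]])
         (use x in \<open>simp add: inverse_eq_divide mult.commute\<close>)
    show "isCont (\<lambda>x. 1 / (sqrt \<bar>x\<bar> * (1 + \<bar>x\<bar>))) x"
      using x by (intro continuous_intros) auto
  next
    have "((\<lambda>x. 2 * arctan (sqrt x)) \<longlongrightarrow> 0) (at_right 0)"
      by real_asymp
    then show "(((\<lambda>x. 2 * arctan (sqrt x)) \<circ> real_of_ereal) \<longlongrightarrow> 0) (at_right 0)"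
      by (simp add: zero_ereal_def ereal_tendsto_simps)
    show "(((\<lambda>x. 2 * arctan (sqrt x)) \<circ> real_of_ereal) \<longlongrightarrow> pi) (at_left \<infinity>)"
      unfolding ereal_tendsto_simps by real_asymp
  qed auto
  then have g: "integrable lborel ?g" by (simp add: set_integrable_def zero_ereal_def)
  then have "integrable lborel (\<lambda>x. ?g (0 + -1 * x))"
    by (rule lborel_integrable_real_affine) simp
  with g have "integrable lborel (\<lambda>x. ?g x + ?g (0 + -1 * x))" by (rule Bochner_Integration.integrable_add)
  \<comment> \<open>At \<open>x = 0\<close> both functions are 0, since division by zero yields
    0.\<close>
  then show ?thesis
    by (rule Bochner_Integration.integrable_cong[THEN iffD1, rotated -1]) (auto simp: indicator_def)
qed

lemma decaying_integrable_square:
  assumes "decaying g" shows "integrable lborel (\<lambda>x. (norm (g x))\<^sup>2)"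
proof -
  from assms obtain C where C: "\<And>x. norm (g x) \<le> C" by (rule decayingE) blast
  have [measurable]: "g \<in> borel_measurable borel" using assms by (rule decaying_measurable)
  have "integrable lborel (\<lambda>x. C * norm (g x))" using decaying_integrable[OF assms] by simp
  then show ?thesis
  proof (rule Bochner_Integration.integrable_bound)
    show "AE x in lborel. norm ((norm (g x))\<^sup>2) \<le> norm (C * norm (g x))"
      using C by (auto simp: power2_eq_square abs_mult intro!: mult_right_mono order_trans[OF C abs_ge_self])
  qed measurable
qed

text \<open>Applies \<open>ln s \<le> s - 1\<close> to \<open>s = sqrt \<bar>x\<bar>\<close> and to
  its inverse.\<close>

lemma abs_ln_abs_le:
  fixes x :: real
  assumes "x \<noteq> 0"
  shows "\<bar>ln \<bar>x\<bar>\<bar> \<le> 2 * ((1 + \<bar>x\<bar>) / sqrt \<bar>x\<bar>)"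
proof -
  define s where "s = sqrt \<bar>x\<bar>"
  have s: "s > 0" "\<bar>x\<bar> = s * s" using assms by (simp_all add: s_def)
  have l: "ln \<bar>x\<bar> = 2 * ln s" using s by (simp add: ln_mult)
  have "ln s \<le> s - 1" using s by (intro ln_le_minus_one)
  moreover have "ln (1 / s) \<le> 1 / s - 1" using s by (intro ln_le_minus_one) simp
  then have "- ln s \<le> 1 / s - 1" using s by (simp add: ln_div)
  moreover have "1 / s > 0" using s by simp
  ultimately have "\<bar>ln \<bar>x\<bar>\<bar> \<le> 2 * (1 / s + s)" using s unfolding l by argo
  also have "\<dots> = 2 * ((1 + \<bar>x\<bar>) / s)" using s by (simp add: field_simps)
  finally show ?thesis by (simp add: s_def)
qed

text \<open>Quadratic decay bounds \<open>(1 + \<bar>x\<bar>)\<^sup>2\<close> times the squared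
  modulus. Both weights are at most a constant times
  \<open>(1 + \<bar>x\<bar>) / sqrt \<bar>x\<bar>\<close>, so both integrands fall below a multiple
  of the majorant above.\<close>

lemma decaying_integrable_weighted:
  assumes "decaying g"
  shows "integrable lborel (\<lambda>x. (norm (g x))\<^sup>2 / sqrt \<bar>x\<bar>)" (is ?A)
    and "integrable lborel (\<lambda>x. (norm (g x))\<^sup>2 * ln \<bar>x\<bar>)" (is ?B)
proof -
  from assms obtain C where C: "\<And>x. norm (g x) \<le> C / (1 + x\<^sup>2)" by (rule decayingE) blast
  have [measurable]: "g \<in> borel_measurable borel" using assms by (rule decaying_measurable)
  have sq: "(1 + \<bar>x\<bar>)\<^sup>2 * (norm (g x))\<^sup>2 \<le> 2 * C\<^sup>2" for x
  proof -
    have "(norm (g x))\<^sup>2 \<le> (C / (1 + x\<^sup>2))\<^sup>2" using C[of x] by (intro power_mono) auto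
    moreover have "(1 + \<bar>x\<bar>)\<^sup>2 \<le> 2 * (1 + x\<^sup>2)"
      using zero_le_power2[of "1 - \<bar>x\<bar>"] by (simp add: power2_eq_square algebra_simps)
    then have "(1 + \<bar>x\<bar>)\<^sup>2 \<le> 2 * (1 + x\<^sup>2)\<^sup>2"
      by (rule order_trans) (use self_le_power[of "1 + x\<^sup>2" 2] in simp)
    ultimately have "(1 + \<bar>x\<bar>)\<^sup>2 * (norm (g x))\<^sup>2 \<le> 2 * (1 + x\<^sup>2)\<^sup>2 * (C / (1 + x\<^sup>2))\<^sup>2"
      by (intro mult_mono) auto
    also have "\<dots> = 2 * C\<^sup>2"
    proof -
      have "1 + x\<^sup>2 \<noteq> 0" by (metis add_pos_nonneg zero_le_power2 zero_less_one less_irrefl)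
      then show ?thesis by (simp add: power_divide)
    qed
    finally show ?thesis .
  qed
  define D where "D x = sqrt \<bar>x\<bar> * (1 + \<bar>x\<bar>)" for x :: real
  have D: "D x > 0" if "x \<noteq> 0" for x using that by (simp add: D_def add_pos_nonneg)
  have key: "(norm (g x))\<^sup>2 * ((1 + \<bar>x\<bar>) / sqrt \<bar>x\<bar>) \<le> 2 * C\<^sup>2 / D x" if "x \<noteq> 0" for x
  proof -
    have "1 + \<bar>x\<bar> > 0" by (simp add: add_pos_nonneg)
    then have "(norm (g x))\<^sup>2 * ((1 + \<bar>x\<bar>) / sqrt \<bar>x\<bar>) = (1 + \<bar>x\<bar>)\<^sup>2 * (norm (g x))\<^sup>2 / D x"
      by (simp add: D_def power2_eq_square)
    also have "\<dots> \<le> 2 * C\<^sup>2 / D x"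
      using D[OF that] by (intro divide_right_mono sq) simp
    finally show ?thesis .
  qed
  have B: "norm ((norm (g x))\<^sup>2 * ln \<bar>x\<bar>) \<le> norm (4 * C\<^sup>2 * (1 / D x))" if "x \<noteq> 0" for x
  proof -
    have "norm ((norm (g x))\<^sup>2 * ln \<bar>x\<bar>) \<le> (norm (g x))\<^sup>2 * (2 * ((1 + \<bar>x\<bar>) / sqrt \<bar>x\<bar>))"
      unfolding real_norm_def abs_mult abs_power2
      by (intro mult_left_mono abs_ln_abs_le[OF that]) simp
    also have "\<dots> \<le> 2 * (2 * C\<^sup>2 / D x)" using key[OF that] by argo
    also have "\<dots> = norm (4 * C\<^sup>2 * (1 / D x))" using D[OF that] by simp
    finally show ?thesis .
  qed
  have A: "norm ((norm (g x))\<^sup>2 / sqrt \<bar>x\<bar>) \<le> norm (4 * C\<^sup>2 * (1 / D x))" if "x \<noteq> 0" for x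
  proof -
    have "norm ((norm (g x))\<^sup>2 / sqrt \<bar>x\<bar>) = (norm (g x))\<^sup>2 * (1 / sqrt \<bar>x\<bar>)" by simp
    also have "\<dots> \<le> (norm (g x))\<^sup>2 * ((1 + \<bar>x\<bar>) / sqrt \<bar>x\<bar>)"
      by (intro mult_left_mono divide_right_mono) auto
    also have "\<dots> \<le> 2 * C\<^sup>2 / D x" by (rule key[OF that])
    also have "\<dots> \<le> norm (4 * C\<^sup>2 * (1 / D x))" using D[OF that] by (simp add: divide_right_mono)
    finally show ?thesis .
  qed
  have I: "integrable lborel (\<lambda>x. 4 * C\<^sup>2 * (1 / D x))"
    unfolding D_def by (rule integrable_mult_right) (rule integrable_inverse_sqrt_weight)
  have nz: "AE x in lborel. x \<noteq> (0::real)" by (rule AE_lborel_singleton)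
  show ?A
  proof (rule Bochner_Integration.integrable_bound[OF I])
    show "AE x in lborel. norm ((norm (g x))\<^sup>2 / sqrt \<bar>x\<bar>) \<le> norm (4 * C\<^sup>2 * (1 / D x))"
      using nz by (rule eventually_mono) (rule A)
  qed measurable
  show ?B
  proof (rule Bochner_Integration.integrable_bound[OF I])
    show "AE x in lborel. norm ((norm (g x))\<^sup>2 * ln \<bar>x\<bar>) \<le> norm (4 * C\<^sup>2 * (1 / D x))"
      using nz by (rule eventually_mono) (rule B)
  qed measurable
qed

lemma mult_le_weighted_squares:
  fixes a b p q :: real
  assumes "p > 0" "q * p = 1"
  shows "a * b \<le> 1/2 * (a\<^sup>2 * p) + 1/2 * (b\<^sup>2 * q)"
proof -
  have q: "q = 1 / p" using assms by (simp add: field_simps)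
  have "0 \<le> (a * p - b)\<^sup>2 / p" using assms by simp
  also have "\<dots> = a\<^sup>2 * p - 2 * (a * b) + b\<^sup>2 * q"
    using assms(1) by (simp add: q field_simps power2_eq_square)
  finally show ?thesis by simp
qed

text \<open>A Schur test with the weight \<open>\<bar>x\<bar> powr (- 1/2)\<close>: the product is
  split by the weighted inequality between arithmetic and geometric means, with
  \<open>p = sqrt (\<bar>x\<bar> / \<bar>x + t\<bar>)\<close>.\<close>

lemma nn_integral_correlation_le:
  fixes h :: "real \<Rightarrow> complex"
  assumes [measurable]: "h \<in> borel_measurable borel"
  shows "(\<integral>\<^sup>+x. ennreal (norm (h x) * norm (h (x + t))) \<partial>lborel)
    \<le> (\<integral>\<^sup>+x. ennreal ((norm (h x))\<^sup>2 * ((sqrt (\<bar>x\<bar> / \<bar>x + t\<bar>) + sqrt (\<bar>x\<bar> / \<bar>x - t\<bar>)) / 2)) \<partial>lborel)"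
proof -
  let ?p = "\<lambda>x. ennreal (1/2 * ((norm (h x))\<^sup>2 * sqrt (\<bar>x\<bar> / \<bar>x + t\<bar>)))"
  let ?q = "\<lambda>x. ennreal (1/2 * ((norm (h (x + t)))\<^sup>2 * sqrt (\<bar>x + t\<bar> / \<bar>x\<bar>)))"
  let ?q' = "\<lambda>x. ennreal (1/2 * ((norm (h x))\<^sup>2 * sqrt (\<bar>x\<bar> / \<bar>x - t\<bar>)))"
  have "(\<integral>\<^sup>+x. ennreal (norm (h x) * norm (h (x + t))) \<partial>lborel) \<le> (\<integral>\<^sup>+x. ?p x + ?q x \<partial>lborel)"
  proof (rule nn_integral_mono_AE)
    show "AE x in lborel. ennreal (norm (h x) * norm (h (x + t))) \<le> ?p x + ?q x"
      using AE_lborel_singleton[of 0] AE_lborel_singleton[of "- t"]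
    proof eventually_elim
      fix x :: real assume x: "x \<noteq> 0" "x \<noteq> - t"
      then have "sqrt (\<bar>x + t\<bar> / \<bar>x\<bar>) * sqrt (\<bar>x\<bar> / \<bar>x + t\<bar>) = 1"
        by (simp add: real_sqrt_mult[symmetric])
      moreover have "sqrt (\<bar>x\<bar> / \<bar>x + t\<bar>) > 0" using x by simp
      ultimately have "ennreal (norm (h x) * norm (h (x + t)))
          \<le> ennreal (1/2 * ((norm (h x))\<^sup>2 * sqrt (\<bar>x\<bar> / \<bar>x + t\<bar>))
               + 1/2 * ((norm (h (x + t)))\<^sup>2 * sqrt (\<bar>x + t\<bar> / \<bar>x\<bar>)))"
        by (intro ennreal_leI mult_le_weighted_squares)
      also have "\<dots> = ?p x + ?q x" by (rule ennreal_plus) auto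
      finally show "ennreal (norm (h x) * norm (h (x + t))) \<le> ?p x + ?q x" .
    qed
  qed
  also have "\<dots> = (\<integral>\<^sup>+x. ?p x \<partial>lborel) + (\<integral>\<^sup>+x. ?q x \<partial>lborel)"
    by (rule nn_integral_add) measurable
  \<comment> \<open>Translation by \<open>t\<close> lets the second term carry \<open>h x\<close> as
    well; its weight now involves \<open>x - t\<close>.\<close>
  also have "(\<integral>\<^sup>+x. ?q x \<partial>lborel) = (\<integral>\<^sup>+x. ?q' x \<partial>lborel)"
    using nn_integral_real_affine[of ?q' 1 t] by (simp add: add.commute)
  also have "(\<integral>\<^sup>+x. ?p x \<partial>lborel) + (\<integral>\<^sup>+x. ?q' x \<partial>lborel) = (\<integral>\<^sup>+x. ?p x + ?q' x \<partial>lborel)"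
    by (rule nn_integral_add[symmetric]) measurable
  also have "\<dots> = (\<integral>\<^sup>+x. ennreal ((norm (h x))\<^sup>2 * ((sqrt (\<bar>x\<bar> / \<bar>x + t\<bar>) + sqrt (\<bar>x\<bar> / \<bar>x - t\<bar>)) / 2)) \<partial>lborel)"
    by (intro nn_integral_cong, subst ennreal_plus[symmetric])
       (auto simp: distrib_left add_divide_distrib)
  finally show ?thesis .
qed

text \<open>The estimate on the side of \<open>h\<close>: Tonelli brings the integral over
  \<open>t\<close> inside, where it is the weight integral at fixed \<open>x\<close>.
  \<open>J\<close> will be the real part of the autocorrelation, written as a cosine
  integral.\<close>

lemma correlation_integral_le:
  fixes h :: "real \<Rightarrow> complex"
  assumes h: "decaying h" and norm1: "(LBINT x. (norm (h x))\<^sup>2) = 1" and e: "0 < \<epsilon>"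
    and J: "\<And>t. J t \<le> norm (LBINT x. h (x + t) * cnj (h x))"
  shows "(LBINT t. indicator {\<epsilon>..R} t / t * J t)
    \<le> 2 * ln 2 + pi / 2 + (LBINT x. (norm (h x))\<^sup>2 * ln \<bar>x\<bar>) - ln \<epsilon>
      + 3 / 2 * sqrt \<epsilon> * (LBINT x. (norm (h x))\<^sup>2 / sqrt \<bar>x\<bar>)" (is "_ \<le> ?X")
proof -
  have [measurable]: "h \<in> borel_measurable borel" using h by (rule decaying_measurable)
  let ?w = "\<lambda>x t. (sqrt (\<bar>x\<bar> / \<bar>x + t\<bar>) + sqrt (\<bar>x\<bar> / \<bar>x - t\<bar>)) / 2"
  let ?V = "\<lambda>x. 2 * ln 2 + pi / 2 + ln \<bar>x\<bar> - ln \<epsilon> + 3 / 2 * sqrt (\<epsilon> / \<bar>x\<bar>)"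
  have V: "(norm (h x))\<^sup>2 * ?V x = (2 * ln 2 + pi / 2 - ln \<epsilon>) * (norm (h x))\<^sup>2
      + 1 * ((norm (h x))\<^sup>2 * ln \<bar>x\<bar>) + 3 / 2 * sqrt \<epsilon> * ((norm (h x))\<^sup>2 / sqrt \<bar>x\<bar>)" for x
    by (simp add: real_sqrt_divide algebra_simps)
  have Vint: "integrable lborel (\<lambda>x. (norm (h x))\<^sup>2 * ?V x)"
    unfolding V by (intro integrable_lincomb3 decaying_integrable_weighted decaying_integrable_square h)
  have X: "(LBINT x. (norm (h x))\<^sup>2 * ?V x) = ?X"
    unfolding V integral_lincomb3[OF decaying_integrable_square[OF h]
        decaying_integrable_weighted(2)[OF h] decaying_integrable_weighted(1)[OF h]] norm1
    by argo
  \<comment> \<open>Nonnegativity allows the final bound to be read back from \<open>ennreal\<close>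
    as a real inequality.\<close>
  have Vpos: "AE x in lborel. 0 \<le> (norm (h x))\<^sup>2 * ?V x"
    using AE_lborel_singleton[of 0]
  proof eventually_elim
    fix x :: real assume x: "x \<noteq> 0"
    have "ln \<epsilon> - ln \<bar>x\<bar> \<le> sqrt (\<epsilon> / \<bar>x\<bar>) + 2 * ln 2 - 2"
      using ln_le_sqrt[of "\<epsilon> / \<bar>x\<bar>"] e x by (simp add: ln_div)
    moreover have "sqrt (\<epsilon> / \<bar>x\<bar>) \<ge> 0" using e by simp
    ultimately have "?V x \<ge> 0" using pi_gt_zero by argo
    then show "0 \<le> (norm (h x))\<^sup>2 * ?V x" by simp
  qed
  have "ennreal (LBINT t. indicator {\<epsilon>..R} t / t * J t)
      \<le> (\<integral>\<^sup>+t. ennreal (indicator {\<epsilon>..R} t / t * J t) \<partial>lborel)"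
    by (rule ennreal_integral_le_nn_integral)
  \<comment> \<open>The upper cutoff \<open>R\<close> is given up here: the remaining integrand is
    nonnegative, and the endpoint \<open>t = \<epsilon>\<close> is a null set.\<close>
  also have "\<dots> \<le> (\<integral>\<^sup>+t. ennreal (indicator {\<epsilon><..} t / t) * (\<integral>\<^sup>+x. ennreal ((norm (h x))\<^sup>2 * ?w x t) \<partial>lborel) \<partial>lborel)"
  proof (rule nn_integral_mono_AE)
    show "AE t in lborel. ennreal (indicator {\<epsilon>..R} t / t * J t)
      \<le> ennreal (indicator {\<epsilon><..} t / t) * (\<integral>\<^sup>+x. ennreal ((norm (h x))\<^sup>2 * ?w x t) \<partial>lborel)"
      using AE_lborel_singleton[of \<epsilon>]
    proof eventually_elim
      fix t assume "t \<noteq> \<epsilon>"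
      then have le: "indicator {\<epsilon>..R} t / t \<le> (indicator {\<epsilon><..} t / t :: real)"
        "0 \<le> (indicator {\<epsilon>..R} t / t :: real)"
        using e by (auto simp: indicator_def)
      have "ennreal (J t) \<le> ennreal (norm (LBINT x. h (x + t) * cnj (h x)))" by (rule ennreal_leI[OF J])
      also have "\<dots> \<le> (\<integral>\<^sup>+x. ennreal (norm (h (x + t) * cnj (h x))) \<partial>lborel)"
        by (rule ennreal_norm_integral_le_nn_integral)
      also have "\<dots> = (\<integral>\<^sup>+x. ennreal (norm (h x) * norm (h (x + t))) \<partial>lborel)"
        by (simp add: norm_mult mult.commute)
      also have "\<dots> \<le> (\<integral>\<^sup>+x. ennreal ((norm (h x))\<^sup>2 * ?w x t) \<partial>lborel)"
        by (rule nn_integral_correlation_le) measurable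
      finally show "ennreal (indicator {\<epsilon>..R} t / t * J t)
        \<le> ennreal (indicator {\<epsilon><..} t / t) * (\<integral>\<^sup>+x. ennreal ((norm (h x))\<^sup>2 * ?w x t) \<partial>lborel)"
        using le by (subst ennreal_mult') (auto intro!: mult_mono ennreal_leI)
    qed
  qed
  also have "\<dots> = (\<integral>\<^sup>+t. (\<integral>\<^sup>+x. ennreal (indicator {\<epsilon><..} t / t) * ennreal ((norm (h x))\<^sup>2 * ?w x t) \<partial>lborel) \<partial>lborel)"
    by (simp add: nn_integral_cmult)
  also have "\<dots> = (\<integral>\<^sup>+x. (\<integral>\<^sup>+t. ennreal (indicator {\<epsilon><..} t / t) * ennreal ((norm (h x))\<^sup>2 * ?w x t) \<partial>lborel) \<partial>lborel)"
    by (rule lborel_pair.Fubini') measurable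
  also have "\<dots> \<le> (\<integral>\<^sup>+x. ennreal ((norm (h x))\<^sup>2 * ?V x) \<partial>lborel)"
  proof (rule nn_integral_mono_AE)
    show "AE x in lborel. (\<integral>\<^sup>+t. ennreal (indicator {\<epsilon><..} t / t) * ennreal ((norm (h x))\<^sup>2 * ?w x t) \<partial>lborel)
       \<le> ennreal ((norm (h x))\<^sup>2 * ?V x)"
      using AE_lborel_singleton[of 0]
    proof eventually_elim
      fix x :: real assume x: "x \<noteq> 0"
      have "ennreal (indicator {\<epsilon><..} t / t) * ennreal ((norm (h x))\<^sup>2 * ?w x t)
          = ennreal ((norm (h x))\<^sup>2) * (ennreal ((sqrt (\<bar>x\<bar> / \<bar>x + t\<bar>) + sqrt (\<bar>x\<bar> / \<bar>x - t\<bar>)) / (2 * t)) * indicator {\<epsilon><..} t)" for t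
      proof (cases "t > \<epsilon>")
        case True
        with e have t: "t > 0" by simp
        have "ennreal (1 / t) * ennreal ((norm (h x))\<^sup>2 * ?w x t) = ennreal (1 / t * ((norm (h x))\<^sup>2 * ?w x t))"
          using t by (intro ennreal_mult'[symmetric]) simp
        also have "1 / t * ((norm (h x))\<^sup>2 * ?w x t) = (norm (h x))\<^sup>2 * ((sqrt (\<bar>x\<bar> / \<bar>x + t\<bar>) + sqrt (\<bar>x\<bar> / \<bar>x - t\<bar>)) / (2 * t))"
          by simp
        also have "ennreal \<dots> = ennreal ((norm (h x))\<^sup>2) * ennreal ((sqrt (\<bar>x\<bar> / \<bar>x + t\<bar>) + sqrt (\<bar>x\<bar> / \<bar>x - t\<bar>)) / (2 * t))"
          by (intro ennreal_mult') simp
        finally show ?thesis using True by simp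
      qed simp
      note eq = this
      have "(\<integral>\<^sup>+t. ennreal (indicator {\<epsilon><..} t / t) * ennreal ((norm (h x))\<^sup>2 * ?w x t) \<partial>lborel)
        = ennreal ((norm (h x))\<^sup>2) * (\<integral>\<^sup>+t. ennreal ((sqrt (\<bar>x\<bar> / \<bar>x + t\<bar>) + sqrt (\<bar>x\<bar> / \<bar>x - t\<bar>)) / (2 * t)) * indicator {\<epsilon><..} t \<partial>lborel)"
        by (subst nn_integral_cong[OF eq], rule nn_integral_cmult) measurable
      also have "\<dots> \<le> ennreal ((norm (h x))\<^sup>2) * ennreal (?V x)"
        by (intro mult_left_mono nn_integral_weight x e) simp
      also have "\<dots> = ennreal ((norm (h x))\<^sup>2 * ?V x)" by (rule ennreal_mult'[symmetric]) simp
      finally show "(\<integral>\<^sup>+t. ennreal (indicator {\<epsilon><..} t / t) * ennreal ((norm (h x))\<^sup>2 * ?w x t) \<partial>lborel)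
       \<le> ennreal ((norm (h x))\<^sup>2 * ?V x)" .
    qed
  qed
  also have "\<dots> = ennreal ?X"
    unfolding X[symmetric] by (rule nn_integral_eq_integral[OF Vint Vpos])
  finally show ?thesis
    using integral_nonneg_AE[OF Vpos] unfolding X by (simp add: ennreal_le_iff)
qed

text \<open>The estimate on the Fourier side: after Fubini, the truncated cosine bound holds for
  each \<open>v \<noteq> 0\<close> and is averaged against the probability density
  \<open>(norm (G v))\<^sup>2\<close>.\<close>

lemma cos_integral_ge:
  fixes G :: "real \<Rightarrow> complex"
  assumes G: "decaying G" and norm1: "(LBINT v. (norm (G v))\<^sup>2) = 1" and e: "0 < \<epsilon>" "\<epsilon> \<le> R"
  shows "(LBINT t. indicator {\<epsilon>..R} t / t * (LBINT v. (norm (G v))\<^sup>2 * cos (t * v)))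
    \<ge> - ln \<epsilon> - (LBINT v. (norm (G v))\<^sup>2 * ln \<bar>v\<bar>) - (1/2 - ln 2 / 2 + 1 / sqrt 2 + 1 / pi)
      - 2 / sqrt R * (LBINT v. (norm (G v))\<^sup>2 / sqrt \<bar>v\<bar>)" (is "_ \<ge> ?Y")
proof -
  have [measurable]: "G \<in> borel_measurable borel" using G by (rule decaying_measurable)
  define K :: real where "K = 1/2 - ln 2 / 2 + 1 / sqrt 2 + 1 / pi"
  let ?I = "\<lambda>v. LBINT t. indicator {\<epsilon>..R} t / t * cos (t * v)"
  let ?L = "\<lambda>v. - ln \<epsilon> - ln \<bar>v\<bar> - K - 2 / sqrt (R * \<bar>v\<bar>)"
  have ind: "set_integrable lborel {\<epsilon>..R} (\<lambda>t::real. cos (t * v) / t)" for v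
    by (rule borel_integrable_atLeastAtMost') (use e in \<open>auto intro!: continuous_intros\<close>)
  have I: "?I v = integral {\<epsilon>..R} (\<lambda>t. cos (t * v) / t)" for v
    using set_borel_integral_eq_integral(2)[OF ind[of v]]
    by (simp add: set_lebesgue_integral_def)
  have g: "integrable lborel (\<lambda>t. indicator {\<epsilon>..R} t / t :: real)"
    using ind[of 0] by (simp add: set_integrable_def)
  note prod = integrable_bounded_kernel[OF decaying_integrable_square[OF G] g, of "\<lambda>v t. cos (t * v)"]
  have "(LBINT t. indicator {\<epsilon>..R} t / t * (LBINT v. (norm (G v))\<^sup>2 * cos (t * v)))
     = (LBINT t. (LBINT v. (norm (G v))\<^sup>2 * (indicator {\<epsilon>..R} t / t) * cos (t * v)))"
    by (subst integral_mult_right_zero[symmetric]) (simp add: mult_ac)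
  also have "\<dots> = (LBINT v. (LBINT t. (norm (G v))\<^sup>2 * (indicator {\<epsilon>..R} t / t) * cos (t * v)))"
    by (rule lborel_pair.Fubini_integral[OF prod]) auto
  finally have eq: "(LBINT t. indicator {\<epsilon>..R} t / t * (LBINT v. (norm (G v))\<^sup>2 * cos (t * v)))
     = (LBINT v. (norm (G v))\<^sup>2 * ?I v)" by (simp only: mult.assoc integral_mult_right_zero)
  have int: "integrable lborel (\<lambda>v. (norm (G v))\<^sup>2 * ?I v)"
  proof -
    have "integrable lborel (\<lambda>v. LBINT t. (norm (G v))\<^sup>2 * (indicator {\<epsilon>..R} t / t) * cos (t * v))"
      by (rule lborel_pair.integrable_fst[OF prod]) auto
    then show ?thesis by (simp only: mult.assoc integral_mult_right_zero)
  qed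
  \<comment> \<open>The averaged lower bound splits into the mass, the logarithmic moment and the
    inverse square root moment, each of them finite.\<close>
  have L: "(norm (G v))\<^sup>2 * ?L v = (- ln \<epsilon> - K) * (norm (G v))\<^sup>2 + (- 1) * ((norm (G v))\<^sup>2 * ln \<bar>v\<bar>)
      + (- 2 / sqrt R) * ((norm (G v))\<^sup>2 / sqrt \<bar>v\<bar>)" for v
    by (simp add: real_sqrt_mult algebra_simps)
  have Lint: "integrable lborel (\<lambda>v. (norm (G v))\<^sup>2 * ?L v)"
    unfolding L by (intro integrable_lincomb3 decaying_integrable_weighted decaying_integrable_square G)
  have "?Y = (LBINT v. (norm (G v))\<^sup>2 * ?L v)"
    unfolding L K_def[symmetric] integral_lincomb3[OF decaying_integrable_square[OF G]
        decaying_integrable_weighted(2)[OF G] decaying_integrable_weighted(1)[OF G]] norm1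
    by simp
  also have "\<dots> \<le> (LBINT v. (norm (G v))\<^sup>2 * ?I v)"
  proof (rule integral_mono_AE[OF Lint int])
    show "AE v in lborel. (norm (G v))\<^sup>2 * ?L v \<le> (norm (G v))\<^sup>2 * ?I v"
      using AE_lborel_singleton[of 0]
    proof eventually_elim
      fix v :: real assume v: "v \<noteq> 0"
      show "(norm (G v))\<^sup>2 * ?L v \<le> (norm (G v))\<^sup>2 * ?I v"
        unfolding I K_def by (intro mult_left_mono integral_cos_scaled_over_ge e v) simp
    qed
  qed
  finally show ?thesis unfolding eq .
qed

lemma fourier_correlation_cos:
  assumes h: "decaying h" "decaying (fourier h)"
  shows "(LBINT v. (norm (fourier h v))\<^sup>2 * cos (t * v)) = Re (LBINT x. h (x + t) * cnj (h x))"
proof -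
  have "integrable lborel (\<lambda>v. complex_of_real ((norm (fourier h v))\<^sup>2))"
    by (rule integrable_of_real) (rule decaying_integrable_square[OF h(2)])
  then have int: "integrable lborel (\<lambda>v. complex_of_real ((norm (fourier h v))\<^sup>2) * cis (t * v))"
    by (rule integrable_mult_cis) simp
  show ?thesis
    unfolding fourier_correlation[OF h] using integral_Re[OF int] by simp
qed

text \<open>The correlation identity at shift \<open>t = 0\<close>.\<close>

lemma plancherel:
  assumes "decaying h" "decaying (fourier h)"
  shows "(LBINT v. (norm (fourier h v))\<^sup>2) = (LBINT x. (norm (h x))\<^sup>2)"
proof -
  have "(LBINT v. (norm (fourier h v))\<^sup>2) = Re (LBINT x. complex_of_real ((norm (h x))\<^sup>2))"
    using fourier_correlation_cos[OF assms, of 0] by (simp only: complex_norm_square) simp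
  then show ?thesis by (simp only: integral_complex_of_real) simp
qed

lemma log_uncertainty:
  assumes h: "decaying h" "decaying (fourier h)" and norm1: "(LBINT x. (norm (h x))\<^sup>2) = 1"
  shows "(LBINT x. (norm (h x))\<^sup>2 * ln \<bar>x\<bar>) + (LBINT v. (norm (fourier h v))\<^sup>2 * ln \<bar>v\<bar>)
    \<ge> - (1/2 - ln 2 / 2 + 1 / sqrt 2 + 1 / pi) - 2 * ln 2 - pi / 2" (is "?B + ?A \<ge> ?c")
proof -
  let ?R = "\<lambda>t. LBINT v. (norm (fourier h v))\<^sup>2 * cos (t * v)"
  define P where "P = (LBINT x. (norm (h x))\<^sup>2 / sqrt \<bar>x\<bar>)"
  define Q where "Q = (LBINT x. (norm (fourier h x))\<^sup>2 / sqrt \<bar>x\<bar>)"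
  note R = fourier_correlation_cos[OF h]
  have normF: "(LBINT v. (norm (fourier h v))\<^sup>2) = 1" using plancherel[OF h] norm1 by simp
  have *: "?c \<le> ?B + ?A + (3 / 2 * P + 2 * Q) / sqrt (real (Suc n))" for n
  proof -
    \<comment> \<open>Both cutoffs are coupled as \<open>1 / r\<close> and \<open>r\<close>. The
      divergent term \<open>- ln (1 / r)\<close> occurs on both sides and cancels, and both errors
      are of order \<open>1 / sqrt r\<close>.\<close>
    define r where "r = real (Suc n)"
    have r: "r \<ge> 1" by (simp add: r_def)
    then have e: "0 < 1 / r" "1 / r \<le> r" using mult_mono[of 1 r 1 r] by (auto simp: field_simps)
    have "- ln (1 / r) - ?A - (1/2 - ln 2 / 2 + 1 / sqrt 2 + 1 / pi) - 2 / sqrt r * Q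
        \<le> 2 * ln 2 + pi / 2 + ?B - ln (1 / r) + 3 / 2 * sqrt (1 / r) * P"
      unfolding P_def Q_def
    proof (rule order_trans[OF cos_integral_ge[OF h(2) normF e] correlation_integral_le[OF h(1) norm1 e(1)]])
      show "?R t \<le> norm (LBINT x. h (x + t) * cnj (h x))" for t
        unfolding R by (rule complex_Re_le_cmod)
    qed
    moreover have "(3 / 2 * P + 2 * Q) / sqrt r = 3 / 2 * sqrt (1 / r) * P + 2 / sqrt r * Q"
      by (simp add: real_sqrt_divide add_divide_distrib)
    ultimately show ?thesis unfolding r_def[symmetric] by argo
  qed
  have "(\<lambda>n. ?B + ?A + (3 / 2 * P + 2 * Q) / sqrt (real (Suc n))) \<longlonglongrightarrow> ?B + ?A"
  proof -
    have "(\<lambda>n. p + q / sqrt (real (Suc n))) \<longlonglongrightarrow> p" for p q :: real by real_asymp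
    then show ?thesis .
  qed
  then show ?thesis by (rule LIMSEQ_le_const) (intro exI allI impI, rule *)
qed

section \<open>Schwartz functions and the offset linear canonical transform\<close>

text \<open>The Schwartz bounds for the function alone. The class is stable under multiplication by
  polynomials and chirps, hence contains the derivatives of a chirped Schwartz function.\<close>

definition rapidly_decaying :: "(real \<Rightarrow> complex) \<Rightarrow> bool" where
  "rapidly_decaying g \<longleftrightarrow> continuous_on UNIV g \<and> (\<forall>m. bounded (range (\<lambda>t. of_real (t ^ m) * g t)))"

text \<open>Adds the bounds for the powers \<open>m = 0\<close> and \<open>m = 2\<close>.\<close>

lemma rapidly_decaying_imp_decaying:
  assumes "rapidly_decaying g" shows "decaying g"
proof -
  obtain A where A: "\<And>t. norm (of_real (t ^ 0) * g t) \<le> A"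
    using assms unfolding rapidly_decaying_def bounded_iff by blast
  obtain B where B: "\<And>t. norm (of_real (t ^ 2) * g t) \<le> B"
    using assms unfolding rapidly_decaying_def bounded_iff by blast
  have "norm (g t) \<le> (A + B) / (1 + t\<^sup>2)" for t
  proof -
    have "(1 + t\<^sup>2) * norm (g t) \<le> A + B"
      using A[of t] B[of t] by (simp add: norm_mult norm_power distrib_right)
    then show ?thesis by (simp add: field_simps add_pos_nonneg)
  qed
  with assms show ?thesis unfolding decaying_def rapidly_decaying_def by blast
qed

lemma rapidly_decaying_add:
  assumes "rapidly_decaying f" "rapidly_decaying g"
  shows "rapidly_decaying (\<lambda>t. f t + g t)"
  using assms unfolding rapidly_decaying_def
  by (auto intro!: continuous_intros bounded_plus_comp simp: distrib_left)

lemma rapidly_decaying_cmult: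
  assumes "rapidly_decaying g" shows "rapidly_decaying (\<lambda>t. c * g t)"
proof -
  have "bounded (range (\<lambda>t. of_real (t ^ m) * (c * g t)))" for m
  proof -
    obtain B where B: "\<And>t. norm (of_real (t ^ m) * g t) \<le> B"
      using assms unfolding rapidly_decaying_def bounded_iff by blast
    have "norm (of_real (t ^ m) * (c * g t)) \<le> norm c * B" for t
      using mult_left_mono[OF B[of t], of "norm c"] by (simp add: norm_mult mult_ac)
    then show ?thesis unfolding bounded_iff by blast
  qed
  with assms show ?thesis unfolding rapidly_decaying_def by (auto intro!: continuous_intros)
qed

lemma rapidly_decaying_mult_id:
  assumes "rapidly_decaying g" shows "rapidly_decaying (\<lambda>t. of_real t * g t)"
proof -
  have "bounded (range (\<lambda>t. of_real (t ^ m) * (of_real t * g t)))" for m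
  proof -
    have "bounded (range (\<lambda>t. of_real (t ^ Suc m) * g t))"
      using assms unfolding rapidly_decaying_def by blast
    then show ?thesis by (simp add: mult_ac)
  qed
  with assms show ?thesis unfolding rapidly_decaying_def by (auto intro!: continuous_intros)
qed

lemma rapidly_decaying_mult_cis:
  assumes "rapidly_decaying g" "continuous_on UNIV \<phi>"
  shows "rapidly_decaying (\<lambda>t. g t * cis (\<phi> t))"
  using assms unfolding rapidly_decaying_def bounded_iff
  by (auto intro!: continuous_intros simp: norm_mult)

lemma schwartz_derivs:
  assumes "f \<in> schwartz"
  shows "rapidly_decaying (nth_vector_derivative n f)"
    and "(nth_vector_derivative n f has_vector_derivative nth_vector_derivative (Suc n) f t) (at t)"
proof -
  have diff: "nth_vector_derivative n f differentiable at t" for t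
    using assms by (simp add: schwartz_def)
  then have "continuous_on UNIV (nth_vector_derivative n f)"
    by (intro continuous_at_imp_continuous_on) (auto intro: differentiable_imp_continuous_within)
  with assms show "rapidly_decaying (nth_vector_derivative n f)"
    by (simp add: schwartz_def rapidly_decaying_def)
  have "nth_vector_derivative (Suc n) f t = vector_derivative (nth_vector_derivative n f) (at t)"
    by (simp add: nth_vector_derivative_def)
  with diff[of t] show "(nth_vector_derivative n f has_vector_derivative nth_vector_derivative (Suc n) f t) (at t)"
    by (simp add: vector_derivative_works)
qed

section \<open>Chirped Schwartz functions and reduction of the transform\<close>

lemma has_vector_derivative_mult_chirp:
  assumes "(g has_vector_derivative g') (at t)"
  shows "((\<lambda>t. g t * cis (\<alpha> * t\<^sup>2 + \<beta> * t)) has_vector_derivative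
    (g' + \<i> * (2 * \<alpha> * t + \<beta>) * g t) * cis (\<alpha> * t\<^sup>2 + \<beta> * t)) (at t)"
proof -
  have "((\<lambda>t. cis (\<alpha> * t\<^sup>2 + \<beta> * t)) has_vector_derivative
      \<i> * (2 * \<alpha> * t + \<beta>) * cis (\<alpha> * t\<^sup>2 + \<beta> * t)) (at t)"
    unfolding has_vector_derivative_def
    by (auto intro!: derivative_eq_intros simp: scaleR_conv_of_real algebra_simps)
  from has_vector_derivative_mult[OF assms this] show ?thesis
    by (rule has_vector_derivative_eq_rhs) (simp add: algebra_simps)
qed

text \<open>A chirp has unimodular values and differentiates to itself times a polynomial. The first
  two derivatives of \<open>h\<close> therefore still decay rapidly, which is what the decay of the
  transform requires.\<close>

lemma decaying_chirp:
  fixes \<alpha> \<beta> :: real and f :: "real \<Rightarrow> complex"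
  assumes f: "f \<in> schwartz"
  defines "h \<equiv> \<lambda>t. f t * cis (\<alpha> * t\<^sup>2 + \<beta> * t)"
  shows "decaying h" "decaying (fourier h)"
proof -
  define E where "E t = cis (\<alpha> * t\<^sup>2 + \<beta> * t)" for t
  \<comment> \<open>\<open>q u\<close> is the contribution of the derivative of the chirp: the
    derivative of \<open>u * E\<close> is \<open>u'\<close> plus \<open>q u\<close>, times
    \<open>E\<close>. Hence \<open>h\<close> has first derivative \<open>g * E\<close> and second
    derivative \<open>(g' + q g) * E\<close>.\<close>
  define q where "q g t = \<i> * (2 * \<alpha> * t + \<beta>) * g t" for g :: "real \<Rightarrow> complex" and t :: real
  let ?f = "\<lambda>n. nth_vector_derivative n f"
  have f0: "?f 0 = f" by (simp add: nth_vector_derivative_def)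
  define g where "g t = ?f 1 t + q f t" for t
  define g' where "g' t = ?f 2 t + (q (?f 1) t + \<i> * (2 * \<alpha>) * f t)" for t
  have q: "rapidly_decaying (q u)" if "rapidly_decaying u" for u
  proof -
    have "q u = (\<lambda>t. \<i> * (2 * \<alpha>) * (of_real t * u t) + \<i> * \<beta> * u t)"
      by (simp add: q_def fun_eq_iff algebra_simps)
    with that show ?thesis
      by (simp only:) (intro rapidly_decaying_add rapidly_decaying_cmult rapidly_decaying_mult_id)
  qed
  have E: "rapidly_decaying (\<lambda>t. u t * E t)" if "rapidly_decaying u" for u
    unfolding E_def by (intro rapidly_decaying_mult_cis that continuous_intros)
  have r: "rapidly_decaying f" "rapidly_decaying (?f 1)" "rapidly_decaying (?f 2)"
    using schwartz_derivs(1)[OF f, of 0] schwartz_derivs(1)[OF f] by (auto simp: f0)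
  have df: "(f has_vector_derivative ?f 1 t) (at t)" for t
    using schwartz_derivs(2)[OF f, of 0 t] by (simp add: f0)
  have df1: "(?f 1 has_vector_derivative ?f 2 t) (at t)" for t
    using schwartz_derivs(2)[OF f, of 1 t] by (simp add: numeral_2_eq_2)
  have dg: "(g has_vector_derivative g' t) (at t)" for t
  proof -
    have "((\<lambda>t. \<i> * (2 * \<alpha> * t + \<beta>)) has_vector_derivative \<i> * (2 * \<alpha>)) (at t)"
      unfolding has_vector_derivative_def
      by (auto intro!: derivative_eq_intros simp: scaleR_conv_of_real algebra_simps)
    from has_vector_derivative_add[OF df1 has_vector_derivative_mult[OF this df]]
    show ?thesis by (simp add: g_def[abs_def] g'_def q_def)
  qed
  have g: "rapidly_decaying g" "rapidly_decaying g'"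
    unfolding g_def[abs_def] g'_def[abs_def]
    by (intro rapidly_decaying_add q r rapidly_decaying_cmult)+
  have h: "h = (\<lambda>t. f t * E t)" by (simp add: h_def E_def)
  show "decaying h" unfolding h by (intro rapidly_decaying_imp_decaying E r)
  moreover have "decaying (\<lambda>t. g t * E t)" by (intro rapidly_decaying_imp_decaying E g)
  moreover have "decaying (\<lambda>t. (g' t + q g t) * E t)"
    by (intro rapidly_decaying_imp_decaying E rapidly_decaying_add q g)
  ultimately show "decaying (fourier h)"
  proof (rule decaying_fourier)
    show "(h has_vector_derivative g t * E t) (at t)" for t
      using has_vector_derivative_mult_chirp[OF df] by (simp add: h_def E_def g_def q_def)
    show "((\<lambda>t. g t * E t) has_vector_derivative (g' t + q g t) * E t) (at t)" for t
      using has_vector_derivative_mult_chirp[OF dg] by (simp add: E_def q_def)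
  qed
qed

lemma norm_olct:
  fixes a b c d \<tau> \<eta> u :: real and f :: "real \<Rightarrow> complex"
  assumes b: "b > 0"
  defines "h \<equiv> \<lambda>t. f t * cis (a / (2 * b) * t\<^sup>2 + \<tau> / b * t)"
  shows "(norm (olct a b c d \<tau> \<eta> f u))\<^sup>2 = (norm (fourier h (u / b)))\<^sup>2 / b"
proof -
  \<comment> \<open>\<theta> collects the terms of the exponent that are free of \<open>t\<close>;
    they contribute a factor of modulus 1.\<close>
  define \<theta> where "\<theta> = - 1 / b * u * (d * \<tau> - b * \<eta>) + d / (2 * b) * (u\<^sup>2 + \<tau>\<^sup>2)"
  define s where "s = csqrt (\<i> * of_real (2 * pi * b))"
  \<comment> \<open>Only the modulus of the root enters; together with the factor of
    \<open>fourier\<close> it leaves \<open>1 / b\<close>.\<close>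
  have ns: "(norm s)\<^sup>2 = 2 * pi * b"
    using b by (simp add: s_def norm_power[symmetric] norm_mult)
  have "f t * olct_kernel a b c d \<tau> \<eta> t u = h t * cis (- (u / b * t)) * (cis \<theta> / s)" for t
  proof -
    have "a / (2 * b) * t\<^sup>2 - 1 / b * t * (u - \<tau>) - 1 / b * u * (d * \<tau> - b * \<eta>) + d / (2 * b) * (u\<^sup>2 + \<tau>\<^sup>2)
        = (a / (2 * b) * t\<^sup>2 + \<tau> / b * t) + - (u / b * t) + \<theta>"
      by (simp add: \<theta>_def algebra_simps diff_divide_distrib)
    then have "olct_kernel a b c d \<tau> \<eta> t u
        = cis ((a / (2 * b) * t\<^sup>2 + \<tau> / b * t) + - (u / b * t) + \<theta>) / s"
      by (simp only: olct_kernel_def s_def[symmetric] cis_conv_exp) simp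
    then show ?thesis by (simp only: h_def cis_mult[symmetric]) simp
  qed
  then have "olct a b c d \<tau> \<eta> f u = (LBINT t. h t * cis (- (u / b * t))) * (cis \<theta> / s)"
    unfolding olct_def by (simp only: integral_mult_left_zero)
  also have "(LBINT t. h t * cis (- (u / b * t))) = sqrt (2 * pi) * fourier h (u / b)"
    by (simp add: fourier_def)
  finally have "(norm (olct a b c d \<tau> \<eta> f u))\<^sup>2 = 2 * pi * (norm (fourier h (u / b)))\<^sup>2 / (norm s)\<^sup>2"
    by (simp add: norm_mult norm_divide power_mult_distrib power_divide)
  then show ?thesis using b by (simp add: ns)
qed

text \<open>The digamma function is increasing, so shifted arguments of \<open>1/4\<close> can be
  compared with those of \<open>1/2\<close>, where its value is known. The terms
  \<open>2 * ln 2\<close> cancel, and rational bounds for the other constants leave a margin of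
  about 0.01.\<close>

lemma Digamma_quarter_le:
  "deriv Gamma (1 / 4 :: real) / Gamma (1 / 4)
   \<le> - (1/2 - ln 2 / 2 + 1 / sqrt 2 + 1 / pi) - 2 * ln 2 - pi / 2"
proof -
  have nn: "(1/4::real) \<notin> \<int>\<^sub>\<le>\<^sub>0" by (auto elim!: nonpos_Ints_cases simp: field_simps)
  have "deriv Gamma (1 / 4 :: real) = Gamma (1/4) * Digamma (1/4)"
    using has_field_derivative_Gamma[OF nn, of UNIV] by (intro DERIV_imp_deriv) simp
  then have eq: "deriv Gamma (1 / 4 :: real) / Gamma (1 / 4) = Digamma (1/4)"
    by (simp add: Gamma_real_pos less_imp_neq[THEN not_sym])
  \<comment> \<open>Four steps of the recurrence make the comparison of \<open>1/4 + n\<close> with \<open>1/2 + n\<close> sharp enough.\<close>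
  have "Digamma (17/4 :: real) = Digamma (1/4) + 4 + 4/5 + 4/9 + 4/13"
    using Digamma_plus1[of "1/4::real"] Digamma_plus1[of "5/4::real"]
      Digamma_plus1[of "9/4::real"] Digamma_plus1[of "13/4::real"] by simp
  moreover have "Digamma (9/2 :: real) = Digamma (1/2) + 2 + 2/3 + 2/5 + 2/7"
    using Digamma_plus1[of "1/2::real"] Digamma_plus1[of "3/2::real"]
      Digamma_plus1[of "5/2::real"] Digamma_plus1[of "7/2::real"] by simp
  moreover have "Digamma (17/4 :: real) \<le> Digamma (9/2)" by (rule Digamma_real_mono) auto
  \<comment> \<open>2.199 is the difference of the two rational sums, about 5.5521 and 3.3524,
    rounded down.\<close>
  ultimately have "Digamma (1/4 :: real) \<le> - euler_mascheroni - 2 * ln 2 - 2.199"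
    using Digamma_one_half[where ?'a = real] by simp
  moreover have "euler_mascheroni > (19/33::real)" by (rule euler_mascheroni_gt_19_over_33)
  moreover have "1 / pi \<le> 0.3184" using pi_approx by (simp add: field_simps)
  moreover have "pi \<le> 3.1416" using pi_approx by simp
  moreover have "1 / sqrt 2 \<le> (0.7072::real)"
    using real_le_rsqrt[of "1/0.7072" 2] by (simp add: field_simps power2_eq_square)
  moreover have "ln 2 \<ge> (2/3::real)" by (rule ln2_ge_two_thirds)
  ultimately show ?thesis unfolding eq by simp
qed

theorem theorem3p9:
  fixes a b c d \<tau> \<eta> :: real and f :: "real \<Rightarrow> complex"
  assumes "a * d - b * c = 1" and "b > 0"
    and "f \<in> schwartz" and "L2_norm f = 1"
  shows "(LBINT t. (cmod (f t))\<^sup>2 * ln \<bar>t\<bar>)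
         + (LBINT u. (cmod (olct a b c d \<tau> \<eta> f u))\<^sup>2 * ln \<bar>u\<bar>)
         \<ge> ln b + deriv Gamma (1 / 4 :: real) / Gamma (1 / 4)"
proof -
  define h where "h t = f t * cis (a / (2 * b) * t\<^sup>2 + \<tau> / b * t)" for t
  let ?F = "fourier h"
  have h: "decaying h" "decaying ?F"
    unfolding h_def[abs_def] by (rule decaying_chirp[OF assms(3)])+
  have nh: "norm (h t) = norm (f t)" for t by (simp add: h_def norm_mult)
  have [measurable]: "?F \<in> borel_measurable borel" using h(2) by (rule decaying_measurable)
  have norm1: "(LBINT t. (norm (h t))\<^sup>2) = 1" using assms(4) by (simp add: nh L2_norm_def)
  have "(LBINT u. (cmod (olct a b c d \<tau> \<eta> f u))\<^sup>2 * ln \<bar>u\<bar>)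
      = (LBINT u. (norm (?F (u / b)))\<^sup>2 / b * ln \<bar>u\<bar>)"
    using norm_olct[OF assms(2)] by (simp add: h_def[abs_def])
  \<comment> \<open>Substitution \<open>u = b * v\<close>; the Jacobian cancels the factor
    \<open>1 / b\<close> of the transform.\<close>
  also have "\<dots> = b * (LBINT v. (norm (?F v))\<^sup>2 / b * ln \<bar>b * v\<bar>)"
    using lborel_integral_real_affine[of b "\<lambda>u. (norm (?F (u / b)))\<^sup>2 / b * ln \<bar>u\<bar>" 0] assms(2) by simp
  also have "\<dots> = (LBINT v. (norm (?F v))\<^sup>2 * ln \<bar>b * v\<bar>)"
    using assms(2) by simp
  \<comment> \<open>The logarithm of the product splits only for \<open>v \<noteq> 0\<close>, as
    \<open>ln 0\<close> is 0 by convention; hence the equality is used almost everywhere.\<close>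
  also have "\<dots> = (LBINT v. ln b * (norm (?F v))\<^sup>2 + (norm (?F v))\<^sup>2 * ln \<bar>v\<bar>)"
  proof (rule integral_cong_AE)
    show "AE v in lborel. (norm (?F v))\<^sup>2 * ln \<bar>b * v\<bar> = ln b * (norm (?F v))\<^sup>2 + (norm (?F v))\<^sup>2 * ln \<bar>v\<bar>"
      using AE_lborel_singleton[of 0]
      by eventually_elim (use assms(2) in \<open>simp add: abs_mult ln_mult algebra_simps\<close>)
  qed measurable
  \<comment> \<open>By Plancherel the transform has total mass 1, which is the coefficient of
    \<open>ln b\<close>.\<close>
  also have "\<dots> = ln b + (LBINT v. (norm (?F v))\<^sup>2 * ln \<bar>v\<bar>)"
    using decaying_integrable_square[OF h(2)] decaying_integrable_weighted(2)[OF h(2)]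
      plancherel[OF h] norm1 by simp
  finally have "(LBINT u. (cmod (olct a b c d \<tau> \<eta> f u))\<^sup>2 * ln \<bar>u\<bar>)
      = ln b + (LBINT v. (norm (?F v))\<^sup>2 * ln \<bar>v\<bar>)" .
  with log_uncertainty[OF h norm1] Digamma_quarter_le show ?thesis by (simp add: nh)
qed

end
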